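(* Let $1<q<p$, let $\Omega\subset\mathbb R^N$ be an exterior domain, with $R>0$ such that $\Omega\supset\{x:|x|>R\}$, and let $u$ be a positive solution of the differential inequality $$-\Delta_p u-\Delta_q u\ge 0\quad\text{in }\Omega .$$ Then the following hold. (i) If $1<q<N$, then for any positive $\theta$ satisfying $\theta\ge\frac{N-q}{q-1}$ there exists a constant $\kappa>0$ such that $$u(x)\ge\kappa|x|^{-\theta}\quad\text{in }|x|>R ,$$ where $\kappa$ depends on $\theta$, $\Omega$ and $u$. (ii) If $q\ge N$, then $\displaystyle\liminf_{|x|\to\infty}u(x)>0$.
   Context: For $r>1$, $\Delta_r u=\operatorname{div}(|\nabla u|^{r-2}\nabla u)$. An exterior domain is a domain $\Omega\subset\mathbb R^N$ with $\Omega\supset\{x:|x|>R\}$ for some $R>0$. A positive solution of $-\Delta_p u-\Delta_q u\ge 0$ in $\Omega$ is a function $u\in C(\Omega)\cap W^{1,p}_{loc}(\Omega)$ with $u>0$ in $\Omega$ such that $$\int_\Omega |\nabla u|^{p-2}\nabla u\cdot\nabla\varphi\,dx+\int_\Omega |\nabla u|^{q-2}\nabla u\cdot\nabla\varphi\,dx\ge 0\quad\text{for all }\varphi\in C^1_c(\Omega),\ \varphi\ge 0.$$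
   Formalization: In (i) the bound is stated on |x|>ρ for each ρ≥R with {|x|≥ρ}⊂Ω (so on |x|>R when the sphere |x|=R lies in Ω); as written it fails for Ω={|x|>R}, N≥2, with a radial increasing solution vanishing at |x|=R. *)

theory Defs
  imports "HOL-Analysis.Analysis"
begin

definition exterior_domain :: "'a::euclidean_space set \<Rightarrow> bool" where
  "exterior_domain \<Omega> \<longleftrightarrow> open \<Omega> \<and> connected \<Omega> \<and> (\<exists>R>0. {x. norm x > R} \<subseteq> \<Omega>)"

text \<open>
  The space of continuously differentiable functions with compact support in \<open>\<Omega>\<close>. Its elements are
  identified with their extension by zero; the gradient \<open>\<psi>\<close> of the test function \<open>\<phi>\<close> is carried along
  explicitly.
\<close>

definition test_function ::
  "'a::euclidean_space set \<Rightarrow> ('a \<Rightarrow> real) \<Rightarrow> ('a \<Rightarrow> 'a) \<Rightarrow> bool" where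
  "test_function \<Omega> \<phi> \<psi> \<longleftrightarrow>
     (\<forall>x. GDERIV \<phi> x :> \<psi> x) \<and> continuous_on UNIV \<psi> \<and>
     compact (closure {x. \<phi> x \<noteq> 0}) \<and> closure {x. \<phi> x \<noteq> 0} \<subseteq> \<Omega>"

definition Lp_loc ::
  "real \<Rightarrow> 'a::euclidean_space set \<Rightarrow> ('a \<Rightarrow> 'b::euclidean_space) \<Rightarrow> bool" where
  "Lp_loc r \<Omega> f \<longleftrightarrow>
     set_borel_measurable lebesgue \<Omega> f \<and>
     (\<forall>K. compact K \<and> K \<subseteq> \<Omega> \<longrightarrow> set_integrable lebesgue K (\<lambda>x. norm (f x) powr r))"

text \<open>
  Integration by parts is required simultaneously for all coordinates, as an identity between
  vector-valued integrals.
\<close>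

definition has_weak_gradient ::
  "'a::euclidean_space set \<Rightarrow> ('a \<Rightarrow> real) \<Rightarrow> ('a \<Rightarrow> 'a) \<Rightarrow> bool" where
  "has_weak_gradient \<Omega> u g \<longleftrightarrow>
     Lp_loc 1 \<Omega> u \<and> Lp_loc 1 \<Omega> g \<and>
     (\<forall>\<phi> \<psi>. test_function \<Omega> \<phi> \<psi> \<longrightarrow>
        (LINT x:\<Omega>|lebesgue. u x *\<^sub>R \<psi> x) = - (LINT x:\<Omega>|lebesgue. \<phi> x *\<^sub>R g x))"

definition W1p_loc :: "real \<Rightarrow> 'a::euclidean_space set \<Rightarrow> ('a \<Rightarrow> real) \<Rightarrow> bool" where
  "W1p_loc r \<Omega> u \<longleftrightarrow> Lp_loc r \<Omega> u \<and> (\<exists>g. has_weak_gradient \<Omega> u g \<and> Lp_loc r \<Omega> g)"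

text \<open>
  The field \<open>|\<xi>|\<^sup>r\<^sup>-\<^sup>2 \<xi>\<close> of the \<open>r\<close>-Laplacian; it vanishes at \<open>\<xi> = 0\<close>, also for \<open>r < 2\<close>.
\<close>

definition plap_field :: "real \<Rightarrow> 'a::euclidean_space \<Rightarrow> 'a" where
  "plap_field r \<xi> = norm \<xi> powr (r - 2) *\<^sub>R \<xi>"

text \<open>
  The weak gradient is unique only up to null sets, on which the integrals do not depend. Hence the
  inequality is required for every representative \<open>g\<close>; one exists by \<^term>\<open>W1p_loc p \<Omega> u\<close>.
\<close>

definition positive_solution ::
  "real \<Rightarrow> real \<Rightarrow> 'a::euclidean_space set \<Rightarrow> ('a \<Rightarrow> real) \<Rightarrow> bool" where
  "positive_solution p q \<Omega> u \<longleftrightarrow>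
     continuous_on \<Omega> u \<and> W1p_loc p \<Omega> u \<and> (\<forall>x\<in>\<Omega>. u x > 0) \<and>
     (\<forall>g. has_weak_gradient \<Omega> u g \<longrightarrow>
       (\<forall>\<phi> \<psi>. test_function \<Omega> \<phi> \<psi> \<and> (\<forall>x. \<phi> x \<ge> 0) \<longrightarrow>
         (LINT x:\<Omega>|lebesgue. plap_field p (g x) \<bullet> \<psi> x) +
         (LINT x:\<Omega>|lebesgue. plap_field q (g x) \<bullet> \<psi> x) \<ge> 0))"

end

theory Submission
  imports Defs
begin

text \<open>
  Let \<open>N\<close> be the dimension.
  For \<open>\<theta> > 0\<close> with \<open>\<theta> (q - 1) \<ge> N - q\<close> the power \<open>w = \<kappa> |x|\<^sup>-\<^sup>\<theta>\<close> is a subsolution for the \<open>q\<close>-Laplacian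
  away from the origin, and, because \<open>\<theta> (p - 1) - (N - p)\<close> is even larger, also for the
  \<open>p\<close>-Laplacian (\<open>power_subsolution\<close>).  Hence \<open>w\<close> is a subsolution of the sum for every \<open>\<kappa> > 0\<close>,
  although the operator is not homogeneous.  Let \<open>m\<close> be the minimum of \<open>u\<close> on the sphere
  \<open>|x| = \<rho>\<close> and choose \<open>\<kappa> = m \<rho>\<^sup>\<theta>\<close>, so that \<open>w = m \<le> u\<close> on that sphere.  Since \<open>w\<close> tends to \<open>0\<close> at
  infinity and \<open>u > 0\<close>, also \<open>w - u < \<epsilon>\<close> on a large outer sphere, and comparison on the
  annulus gives \<open>u \<ge> m (|x| / \<rho>)\<^sup>-\<^sup>\<theta>\<close> outside \<open>|x| = \<rho>\<close> (\<open>radial_lower_bound\<close>).  That is the first claim.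
  If \<open>q \<ge> N\<close>, every \<open>\<theta> > 0\<close> is admissible with the same \<open>m\<close>; letting \<open>\<theta>\<close> tend to \<open>0\<close> yields
  \<open>u \<ge> m\<close>, which is the second claim.

  The comparison principle (\<open>weak_comparison\<close>) tests both inequalities with \<open>\<eta> (w - u)\<close>,
  where \<open>\<eta> s = (max 0 (s - T))\<^sup>2\<close>.  With \<open>A\<close> the sum of the two fields this gives
  \<open>\<integral> \<eta>' (w - u) (A (\<nabla>w) - A (\<nabla>u)) \<bullet> (\<nabla>w - \<nabla>u) \<le> 0\<close>, and strict monotonicity of \<open>A\<close>
  (\<open>plap_field_strict_mono\<close>) forces \<open>\<nabla>u = \<nabla>w\<close> wherever \<open>w - u > T\<close>.  So \<open>\<eta> (w - u)\<close> has zero gradient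
  and compact support, hence vanishes; here this is read off from
  \<open>\<integral> \<nabla>F \<bullet> x = - N \<integral> F\<close> (\<open>integral_gradient_inner_position\<close>).

  Test functions must be continuously differentiable, which \<open>u\<close> need not be.  Therefore \<open>u\<close> alone
  is replaced by mollifications \<open>v n\<close> in the test function.  They converge to \<open>u\<close>
  locally uniformly, and their gradients converge to \<open>\<nabla>u\<close> in \<open>L\<^sup>p\<close>
  (\<open>local_smooth_approximation\<close>), which is exactly what the limit passage in the tested
  inequalities needs because \<open>|A \<xi>| \<le> 2 (1 + |\<xi>|)\<^sup>p\<^sup>-\<^sup>1\<close> (\<open>weighted_flux_tendsto\<close>).
\<close>

section \<open>Gradients and integrals of continuous functions\<close>

text \<open>
  The square of the positive part is the simplest truncation that is still continuously
  differentiable; it shapes both the mollifying kernel and the test functions below.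
\<close>

lemma DERIV_max_0_sq: "DERIV (\<lambda>t::real. (max 0 t)\<^sup>2) t :> 2 * max 0 t"
proof (rule linorder_cases[of t 0])
  assume "t < 0"
  have "DERIV (\<lambda>t::real. 0) t :> 2 * max 0 t"
    using \<open>t < 0\<close> by simp
  then show ?thesis
    by (rule has_field_derivative_transform_within_open[where S = "{..<0}"]) (use \<open>t < 0\<close> in auto)
next
  assume "t > 0"
  have "DERIV (\<lambda>t::real. t\<^sup>2) t :> 2 * max 0 t"
    using \<open>t > 0\<close> by (auto intro!: derivative_eq_intros)
  then show ?thesis
    by (rule has_field_derivative_transform_within_open[where S = "{0<..}"]) (use \<open>t > 0\<close> in auto)
next
  assume t: "t = 0"
  have "((\<lambda>h. (max 0 h)\<^sup>2 / h) \<longlongrightarrow> 0) (at (0::real))"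
  proof (rule tendsto_rabs_zero_cancel, rule tendsto_sandwich[where f = "\<lambda>_. 0" and h = "\<lambda>h. \<bar>h\<bar>"])
    show "\<forall>\<^sub>F h in at 0. \<bar>(max 0 h)\<^sup>2 / h\<bar> \<le> \<bar>h :: real\<bar>"
      by (intro always_eventually allI) (auto simp: max_def power2_eq_square)
  qed (auto intro!: tendsto_eq_intros)
  with t show ?thesis
    by (simp add: DERIV_def)
qed

lemma GDERIV_transform_open:
  assumes "GDERIV f x :> D" "open S" "x \<in> S" "\<And>y. y \<in> S \<Longrightarrow> f y = g y"
  shows "GDERIV g x :> D"
  using assms has_derivative_transform_within_open[of f _ x UNIV S g]
  unfolding gderiv_def by auto

lemma GDERIV_inner_self: "GDERIV (\<lambda>x. x \<bullet> x) x :> 2 *\<^sub>R x"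
  unfolding gderiv_def by (auto intro!: derivative_eq_intros simp: inner_commute)

lemma GDERIV_inner_const: "GDERIV (\<lambda>x. x \<bullet> e) x :> e"
  unfolding gderiv_def by (auto intro!: derivative_eq_intros)

lemma continuous_nonneg_integral_pos:
  fixes f :: "'a::euclidean_space \<Rightarrow> real"
  assumes "continuous_on UNIV f" "\<And>x. f x \<ge> 0" "integrable lborel f" "f a > 0"
  shows "(LINT x|lborel. f x) > 0"
proof (rule ccontr)
  assume "\<not> ?thesis"
  then have "(LINT x|lborel. f x) = 0"
    using Bochner_Integration.integral_nonneg[of lborel f] assms(2) by (simp add: order.antisym)
  then have "AE x in lborel. f x = 0"
    using assms by (subst (asm) integral_nonneg_eq_0_iff_AE) auto
  moreover have op: "open {x. 0 < f x}"
    using assms(1) by (intro open_Collect_less) auto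
  ultimately have "{x. 0 < f x} \<in> null_sets lborel"
    using assms(1) by (subst AE_iff_null_sets) (auto elim!: eventually_mono)
  then have "negligible {x. 0 < f x}"
    by (simp add: negligible_iff_null_sets null_sets_completionI)
  then have "{x. 0 < f x} = {}"
    using op open_not_negligible by blast
  with assms(4) show False by auto
qed

lemma integrable_continuous_compact_support:
  fixes f :: "'a::euclidean_space \<Rightarrow> 'b::euclidean_space"
  assumes "continuous_on UNIV f" "compact K" "\<And>x. x \<notin> K \<Longrightarrow> f x = 0"
  shows "integrable lborel f"
proof -
  have "set_integrable lborel K f"
    unfolding set_integrable_def
    using borel_integrable_compact[OF assms(2) continuous_on_subset[OF assms(1)]] by auto
  moreover have "(\<lambda>x. indicator K x *\<^sub>R f x) = f"
    using assms(3) by (auto simp: indicator_def fun_eq_iff)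
  ultimately show ?thesis by (simp add: set_integrable_def)
qed

lemma integral_lborel_translate:
  fixes f :: "'a::euclidean_space \<Rightarrow> 'b::euclidean_space"
  assumes [measurable]: "f \<in> borel_measurable borel"
  shows "(LINT x|lborel. f (x + a)) = (LINT x|lborel. f x)"
    and "integrable lborel f \<Longrightarrow> integrable lborel (\<lambda>x. f (x + a))"
proof -
  have "(LINT x|lborel. f x) = (LINT x|distr lborel borel ((+) a). f x)"
    by (simp add: lborel_distr_plus)
  also have "\<dots> = (LINT x|lborel. f (a + x))"
    by (rule integral_distr) auto
  finally show "(LINT x|lborel. f (x + a)) = (LINT x|lborel. f x)"
    by (simp add: add.commute)
  assume "integrable lborel f"
  then have "integrable (distr lborel borel ((+) a)) f"
    by (simp add: lborel_distr_plus)
  then show "integrable lborel (\<lambda>x. f (x + a))"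
    by (subst (asm) integrable_distr_eq) (auto simp: add.commute)
qed

section \<open>A mollifying kernel\<close>

text \<open>
  The kernel is the squared positive part of a quadratic, normalised to mass one.  A kernel of class \<open>C\<^sup>1\<close> is enough,
  since test functions are only required to be continuously differentiable.
\<close>

definition bump_mass :: "'a::euclidean_space itself \<Rightarrow> real \<Rightarrow> real" where
  "bump_mass _ e = (LINT y|lborel. (max 0 (e\<^sup>2 - (y::'a) \<bullet> y))\<^sup>2)"

definition bump :: "real \<Rightarrow> 'a::euclidean_space \<Rightarrow> real" where
  "bump e x = (max 0 (e\<^sup>2 - x \<bullet> x))\<^sup>2 / bump_mass TYPE('a) e"

definition bump_grad :: "real \<Rightarrow> 'a::euclidean_space \<Rightarrow> 'a" where
  "bump_grad e x = (- 4 * max 0 (e\<^sup>2 - x \<bullet> x) / bump_mass TYPE('a) e) *\<^sub>R x"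

lemma continuous_on_bump [continuous_intros]: "continuous_on S (bump e)"
  unfolding bump_def[abs_def] divide_inverse by (intro continuous_intros)

lemma continuous_on_bump_grad [continuous_intros]: "continuous_on S (bump_grad e)"
  unfolding bump_grad_def[abs_def] divide_inverse by (intro continuous_intros)

lemma bump_measurable [measurable]: "bump e \<in> borel_measurable borel"
  by (intro borel_measurable_continuous_onI continuous_intros)

lemma bump_grad_measurable [measurable]: "bump_grad e \<in> borel_measurable borel"
  by (intro borel_measurable_continuous_onI continuous_intros)

lemma bump_minus [simp]: "bump e (- x) = bump e x"
  by (simp add: bump_def)

lemma bump_grad_minus [simp]: "bump_grad e (- x) = - bump_grad e x"
  by (simp add: bump_grad_def)

lemma inner_self_ge_sq: "e > 0 \<Longrightarrow> norm x \<ge> e \<Longrightarrow> x \<bullet> x \<ge> e\<^sup>2"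
  by (simp add: dot_square_norm power_mono)

lemma bump_eq_0: "e > 0 \<Longrightarrow> norm x \<ge> e \<Longrightarrow> bump e x = 0"
  using inner_self_ge_sq[of e x] by (simp add: bump_def max_def)

lemma bump_grad_eq_0: "e > 0 \<Longrightarrow> norm x \<ge> e \<Longrightarrow> bump_grad e x = 0"
  using inner_self_ge_sq[of e x] by (simp add: bump_grad_def max_def)

lemma bump_mass_pos:
  assumes "e > 0" shows "bump_mass TYPE('a::euclidean_space) e > 0"
  unfolding bump_mass_def
proof (rule continuous_nonneg_integral_pos)
  show cont: "continuous_on UNIV (\<lambda>y::'a. (max 0 (e\<^sup>2 - y \<bullet> y))\<^sup>2)"
    by (intro continuous_intros)
  show "integrable lborel (\<lambda>y::'a. (max 0 (e\<^sup>2 - y \<bullet> y))\<^sup>2)"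
  proof (rule integrable_continuous_compact_support[OF cont compact_cball[of 0 e]])
    show "(max 0 (e\<^sup>2 - y \<bullet> y))\<^sup>2 = 0" if "y \<notin> cball 0 e" for y :: 'a
      using inner_self_ge_sq[OF assms, of y] that by simp
  qed
  show "(max 0 (e\<^sup>2 - (0::'a) \<bullet> 0))\<^sup>2 > 0"
    using assms by simp
qed auto

lemma bump_nonneg: "e > 0 \<Longrightarrow> bump e (x :: 'a::euclidean_space) \<ge> 0"
  using bump_mass_pos[of e, where 'a = 'a] by (simp add: bump_def)

lemma integrable_bump: "e > 0 \<Longrightarrow> integrable lborel (bump e :: 'a::euclidean_space \<Rightarrow> real)"
  by (rule integrable_continuous_compact_support[OF continuous_on_bump compact_cball[of 0 e]])
     (auto intro: bump_eq_0)

lemma integral_bump: "e > 0 \<Longrightarrow> (LINT x|lborel. bump e (x::'a::euclidean_space)) = 1"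
proof -
  assume "e > 0"
  have "(LINT x|lborel. bump e (x::'a)) = bump_mass TYPE('a) e / bump_mass TYPE('a) e"
    by (simp add: bump_def bump_mass_def)
  with bump_mass_pos[OF \<open>e > 0\<close>, where 'a = 'a] show ?thesis by simp
qed

lemma bump_diff_commute: "bump e (x - y) = bump e (y - x)"
  by (metis bump_minus minus_diff_eq)

lemma
  assumes "e > 0"
  shows integrable_bump_diff: "integrable lborel (\<lambda>y. bump e (x - y :: 'a::euclidean_space))"
    and integral_bump_diff: "(LINT y|lborel. bump e (x - y :: 'a)) = 1"
  using integral_lborel_translate[of "bump e" "- x"] integral_bump[OF assms, where 'a = 'a] integrable_bump[OF assms, where 'a = 'a]
  by (auto simp: bump_diff_commute[of e x])

lemma nn_integral_bump_diff:
  assumes "e > 0"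
  shows "(\<integral>\<^sup>+x. bump e (x - y :: 'a::euclidean_space) \<partial>lborel) = 1"
proof -
  have *: "bump e (x - y) = bump e (y - x)" for x by (rule bump_diff_commute)
  show ?thesis
    unfolding * using integrable_bump_diff[OF assms, of y] integral_bump_diff[OF assms, of y] bump_nonneg[OF assms]
    by (subst nn_integral_eq_integral) auto
qed

lemma GDERIV_bump: "GDERIV (bump e) x :> bump_grad e x"
proof -
  have 1: "GDERIV (\<lambda>x::'a. e\<^sup>2 - x \<bullet> x) x :> 0 - 2 *\<^sub>R x"
    by (intro GDERIV_diff GDERIV_const GDERIV_inner_self)
  have "GDERIV (\<lambda>x::'a. (max 0 (e\<^sup>2 - x \<bullet> x))\<^sup>2) x :> (2 * max 0 (e\<^sup>2 - x \<bullet> x)) *\<^sub>R (0 - 2 *\<^sub>R x)"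
    by (rule GDERIV_DERIV_compose[OF 1 DERIV_max_0_sq])
  from GDERIV_mult[OF this GDERIV_const[where k = "inverse (bump_mass TYPE('a) e)"]]
  show ?thesis
    unfolding bump_def[abs_def] divide_inverse
    by (rule GDERIV_subst) (simp add: bump_grad_def divide_inverse)
qed

lemma bounded_continuous_compact_support:
  fixes f :: "'a::euclidean_space \<Rightarrow> 'b::euclidean_space"
  assumes "continuous_on UNIV f" "compact K" "\<And>x. x \<notin> K \<Longrightarrow> f x = 0"
  obtains B where "B > 0" "\<And>x. norm (f x) \<le> B"
proof -
  have "bounded (f ` K)"
    by (intro compact_imp_bounded compact_continuous_image continuous_on_subset[OF assms(1)] assms(2)) auto
  then obtain B where B: "B > 0" "\<And>x. x \<in> K \<Longrightarrow> norm (f x) \<le> B"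
    unfolding bounded_pos by auto
  then have "norm (f x) \<le> B" for x
    using assms(3)[of x] by (cases "x \<in> K") auto
  with B(1) that show thesis by blast
qed

definition mollify :: "real \<Rightarrow> ('a::euclidean_space \<Rightarrow> 'b::euclidean_space) \<Rightarrow> 'a \<Rightarrow> 'b" where
  "mollify e f x = (LINT y|lborel. bump e (x - y) *\<^sub>R f y)"

text \<open>
  Both facts are dominated by a multiple of \<open>norm (f y)\<close>, because the kernel is bounded.
\<close>

lemma
  fixes f :: "'a::euclidean_space \<Rightarrow> 'b::euclidean_space"
  assumes e: "e > 0" and f: "integrable lborel f"
  shows mollify_integrable: "integrable lborel (\<lambda>y. bump e (x - y) *\<^sub>R f y)"
    and continuous_on_mollify: "continuous_on UNIV (mollify e f)"
proof -
  have [measurable]: "f \<in> borel_measurable borel" using f by auto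
  obtain B where B: "\<And>x::'a. norm (bump e x) \<le> B"
    using bounded_continuous_compact_support[OF continuous_on_bump compact_cball[of 0 e], of e]
      bump_eq_0[OF e] by (metis less_le_not_le linorder_linear mem_cball_0)
  have le: "norm (bump e (x - y) *\<^sub>R f y) \<le> norm (B * norm (f y))" for x y
    using mult_right_mono[OF B[of "x - y"], of "norm (f y)"] by auto
  have int: "integrable lborel (\<lambda>y. B * norm (f y))" using f by auto
  show "integrable lborel (\<lambda>y. bump e (x - y) *\<^sub>R f y)"
    by (rule Bochner_Integration.integrable_bound[OF int]) (use le in auto)
  show "continuous_on UNIV (mollify e f)"
    unfolding continuous_on_sequentially comp_def mollify_def
  proof safe
    fix X :: "nat \<Rightarrow> 'a" and a assume X: "X \<longlonglongrightarrow> a"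
    show "(\<lambda>n. LINT y|lborel. bump e (X n - y) *\<^sub>R f y) \<longlonglongrightarrow> (LINT y|lborel. bump e (a - y) *\<^sub>R f y)"
    proof (rule integral_dominated_convergence[OF _ _ int])
      show "AE y in lborel. (\<lambda>n. bump e (X n - y) *\<^sub>R f y) \<longlonglongrightarrow> bump e (a - y) *\<^sub>R f y"
        using X by (intro AE_I2 tendsto_intros continuous_on_tendsto_compose[OF continuous_on_bump[of UNIV]]) auto
      show "AE y in lborel. norm (bump e (X n - y) *\<^sub>R f y) \<le> B * norm (f y)" for n
        using B by (auto intro!: AE_I2 mult_right_mono)
    qed auto
  qed
qed

text \<open>
  Differentiation under the integral sign: the kernel is Lipschitz, so its first-order
  remainders divided by \<open>norm h\<close> are bounded uniformly and dominated convergence applies.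
\<close>

lemma GDERIV_mollify:
  fixes U :: "'a::euclidean_space \<Rightarrow> real"
  assumes e: "e > 0" and U: "integrable lborel U"
  shows "GDERIV (mollify e U) x :> (LINT y|lborel. U y *\<^sub>R bump_grad e (x - y))"
proof -
  have [measurable]: "U \<in> borel_measurable borel" using U by auto
  obtain B where B: "B > 0" "\<And>x::'a. norm (bump_grad e x) \<le> B"
    using bounded_continuous_compact_support[OF continuous_on_bump_grad compact_cball[of 0 e], of e]
      bump_grad_eq_0[OF e] by (metis less_le_not_le linorder_linear mem_cball_0)
  have lip: "\<bar>bump e (x + h) - bump e x\<bar> \<le> B * norm h" for x h :: 'a
  proof -
    have "norm (bump e (x + h) - bump e x) \<le> B * norm (x + h - x)"
    proof (rule differentiable_bound[where S = UNIV and f' = "\<lambda>x h. h \<bullet> bump_grad e x"])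
      show "onorm (\<lambda>h. h \<bullet> bump_grad e x) \<le> B" for x :: 'a
        using B(2)[of x] by (intro onorm_le) (smt (verit, ccfv_SIG) Cauchy_Schwarz_ineq2 mult.commute mult_right_mono norm_ge_zero real_norm_def)
    qed (use GDERIV_bump in \<open>auto simp: gderiv_def\<close>)
    then show ?thesis by simp
  qed
  have Bint: "integrable lborel (\<lambda>y. (2 * B) * norm (U y))" using U by auto
  have intg: "integrable lborel (\<lambda>y. U y *\<^sub>R bump_grad e (x - y))"
  proof (rule Bochner_Integration.integrable_bound[OF Bint])
    show "AE y in lborel. norm (U y *\<^sub>R bump_grad e (x - y)) \<le> norm (2 * B * norm (U y))"
    proof (intro AE_I2)
      fix y
      have "\<bar>U y\<bar> * norm (bump_grad e (x - y)) \<le> \<bar>U y\<bar> * (2 * B)"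
        using B(1) B(2)[of "x - y"] by (intro mult_left_mono) auto
      then show "norm (U y *\<^sub>R bump_grad e (x - y)) \<le> norm (2 * B * norm (U y))"
        using B(1) by (simp add: abs_mult ac_simps)
    qed
  qed auto
  \<comment> \<open>The first-order remainder of the kernel at \<open>x - y\<close>, per unit of increment.\<close>
  define q where "q h y = (bump e (x + h - y) - bump e (x - y) - h \<bullet> bump_grad e (x - y)) / norm h" for h y
  have q_lim: "((\<lambda>h. q h y) \<longlongrightarrow> 0) (at 0)" for y
    using GDERIV_bump[of e "x - y"]
    unfolding gderiv_def has_derivative_at q_def
    by (auto simp: algebra_simps intro: tendsto_norm_zero_cancel)
  have q_bound: "\<bar>q h y\<bar> \<le> 2 * B" for h y
  proof (cases "h = 0")
    case False
    have "\<bar>h \<bullet> bump_grad e (x - y)\<bar> \<le> norm h * B"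
      using Cauchy_Schwarz_ineq2[of h "bump_grad e (x - y)"] mult_left_mono[OF B(2)[of "x - y"], of "norm h"] by simp
    moreover have "\<bar>bump e (x + h - y) - bump e (x - y)\<bar> \<le> B * norm h"
      using lip[of "x - y" h] by (simp add: algebra_simps)
    ultimately have "\<bar>bump e (x + h - y) - bump e (x - y) - h \<bullet> bump_grad e (x - y)\<bar> \<le> 2 * B * norm h"
      by (simp add: algebra_simps)
    with False show ?thesis by (simp add: q_def divide_le_eq)
  qed (use B in \<open>simp add: q_def\<close>)
  have eq: "(mollify e U (x + h) - mollify e U x - h \<bullet> (LINT y|lborel. U y *\<^sub>R bump_grad e (x - y))) / norm h
     = (LINT y|lborel. U y * q h y)" for h
  proof -
    have "(LINT y|lborel. U y * q h y) = (LINT y|lborel. (bump e (x + h - y) *\<^sub>R U y - bump e (x - y) *\<^sub>R U y - h \<bullet> (U y *\<^sub>R bump_grad e (x - y))) / norm h)"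
      by (intro Bochner_Integration.integral_cong) (auto simp: q_def algebra_simps diff_divide_distrib)
    also have "\<dots> = (mollify e U (x + h) - mollify e U x - h \<bullet> (LINT y|lborel. U y *\<^sub>R bump_grad e (x - y))) / norm h"
      using mollify_integrable[OF e U, of "x + h"] mollify_integrable[OF e U, of x] intg
      by (simp add: mollify_def del: inner_scaleR_right)
    finally show ?thesis ..
  qed
  have "((\<lambda>h. LINT y|lborel. U y * q h y) \<longlongrightarrow> 0) (at 0)"
    unfolding tendsto_at_iff_sequentially comp_def
  proof safe
    fix X :: "nat \<Rightarrow> 'a" assume X: "\<forall>i. X i \<in> UNIV - {0}" "X \<longlonglongrightarrow> 0"
    have "(\<lambda>n. LINT y|lborel. U y * q (X n) y) \<longlonglongrightarrow> (LINT (y::'a)|lborel. (0::real))"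
    proof (rule integral_dominated_convergence[OF _ _ Bint])
      show "AE y in lborel. (\<lambda>n. U y * q (X n) y) \<longlonglongrightarrow> 0"
      proof (intro AE_I2 tendsto_mult_right_zero)
        fix y show "(\<lambda>n. q (X n) y) \<longlonglongrightarrow> 0"
          using q_lim[of y] X unfolding tendsto_at_iff_sequentially comp_def by blast
      qed
      show "AE y in lborel. norm (U y * q (X n) y) \<le> 2 * B * norm (U y)" for n
        using mult_left_mono[OF q_bound[of "X n"]] by (auto intro!: AE_I2 simp: abs_mult mult.commute)
      show "(\<lambda>y. U y * q (X n) y) \<in> borel_measurable lborel" for n
        unfolding q_def by measurable
    qed auto
    then show "(\<lambda>n. LINT y|lborel. U y * q (X n) y) \<longlonglongrightarrow> 0" by simp
  qed
  then have lim: "((\<lambda>h. (mollify e U (x + h) - mollify e U x - h \<bullet> (LINT y|lborel. U y *\<^sub>R bump_grad e (x - y))) / norm h) \<longlongrightarrow> 0) (at 0)"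
    unfolding eq .
  show ?thesis
    unfolding gderiv_def has_derivative_at using tendsto_norm_zero[OF lim]
    by (auto intro: bounded_linear_inner_left)
qed

section \<open>Mollification in Lp\<close>

lemma powr_add_le:
  fixes a b p :: real
  assumes "a \<ge> 0" "b \<ge> 0" "p \<ge> 0"
  shows "(a + b) powr p \<le> 2 powr p * (a powr p + b powr p)"
proof -
  have "(a + b) powr p \<le> (2 * max a b) powr p"
    using assms by (intro powr_mono2) auto
  also have "\<dots> = 2 powr p * max a b powr p"
    using assms by (simp add: powr_mult)
  also have "\<dots> \<le> 2 powr p * (a powr p + b powr p)"
    using assms by (intro mult_left_mono) (auto simp: max_def)
  finally show ?thesis .
qed

text \<open>
  The graph of \<open>s \<mapsto> s\<^sup>p\<close> lies above its tangent at \<open>b\<close>.  The inequality is Young's, and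
  integrating it in \<open>a\<close> yields Jensen's inequality for the mollifying kernel.
\<close>

lemma powr_tangent_le:
  fixes a b p :: real
  assumes "a \<ge> 0" "b \<ge> 0" "p > 1"
  shows "b powr p + p * b powr (p - 1) * (a - b) \<le> a powr p"
proof -
  have eq: "(b powr (p - 1)) powr (p / (p - 1)) = b powr p"
    using assms by (simp add: powr_powr)
  have "a * b powr (p - 1) \<le> a powr p / p + (b powr (p - 1)) powr (p / (p - 1)) / (p / (p - 1))"
    by (rule Youngs_inequality) (use assms in \<open>auto simp: field_simps\<close>)
  then have "p * (a * b powr (p - 1)) \<le> a powr p + (p - 1) * b powr p"
    unfolding eq using assms by (simp add: field_simps)
  moreover have "b powr p = b powr (p - 1) * b"
    using assms by (cases "b = 0") (auto simp: powr_diff)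
  ultimately show ?thesis
    by (simp add: algebra_simps)
qed

definition truncate_norm :: "real \<Rightarrow> 'b::real_normed_vector \<Rightarrow> 'b" where
  "truncate_norm M y = (M / max M (norm y)) *\<^sub>R y"

definition cutoff :: "real \<Rightarrow> 'a::real_normed_vector \<Rightarrow> real" where
  "cutoff r x = max 0 (1 - norm x / r)"

lemma continuous_on_truncate_norm: "M > 0 \<Longrightarrow> continuous_on S (truncate_norm M)"
  unfolding truncate_norm_def[abs_def] by (intro continuous_intros) auto

lemma norm_truncate_norm_le: "M > 0 \<Longrightarrow> norm (truncate_norm M y) \<le> M"
  by (simp add: truncate_norm_def abs_mult field_simps max_def)

lemma truncate_norm_eq: "M > 0 \<Longrightarrow> norm y \<le> M \<Longrightarrow> truncate_norm M y = y"
  by (simp add: truncate_norm_def max_def)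

lemma continuous_on_cutoff: "r > 0 \<Longrightarrow> continuous_on S (cutoff r)"
  unfolding cutoff_def[abs_def] by (intro continuous_intros) auto

lemma cutoff_bounds: "r > 0 \<Longrightarrow> 0 \<le> cutoff r x \<and> cutoff r x \<le> 1"
  by (simp add: cutoff_def)

lemma cutoff_eq_0: "r > 0 \<Longrightarrow> norm x \<ge> r \<Longrightarrow> cutoff r x = 0"
  by (simp add: cutoff_def)

text \<open>
  Cutting off and truncating multiplies \<open>y\<close> by a factor in \<open>[0, 1]\<close>.  Hence the error is dominated
  by \<open>y\<close> itself, as dominated convergence in \<open>L\<^sup>p\<close> requires.
\<close>

lemma norm_diff_truncate_le:
  assumes "M > 0"
  shows "norm (y - cutoff M x *\<^sub>R truncate_norm M y) \<le> norm y"
proof -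
  define c where "c = cutoff M x * (M / max M (norm y))"
  have c: "0 \<le> c" "c \<le> 1"
    using assms cutoff_bounds[OF assms, of x] unfolding c_def
    by (auto intro!: mult_le_one simp del: times_divide_eq_right)
  have "y - cutoff M x *\<^sub>R truncate_norm M y = (1 - c) *\<^sub>R y"
    by (simp add: truncate_norm_def c_def algebra_simps)
  then show ?thesis
    using c by (simp add: mult_left_le_one_le)
qed

lemma truncate_tendsto: "(\<lambda>n. cutoff (real (Suc n)) x *\<^sub>R truncate_norm (real (Suc n)) y) \<longlonglongrightarrow> y"
proof -
  have "(\<lambda>n. norm x / real (Suc n)) \<longlonglongrightarrow> 0"
    by real_asymp
  then have "(\<lambda>n. cutoff (real (Suc n)) x) \<longlonglongrightarrow> max 0 (1 - 0)"
    unfolding cutoff_def by (intro tendsto_intros)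
  moreover have "\<forall>\<^sub>F n in sequentially. truncate_norm (real (Suc n)) y = y"
    using eventually_ge_at_top[of "nat \<lceil>norm y\<rceil>"]
  proof eventually_elim
    case (elim n)
    then have "norm y \<le> real (Suc n)" by linarith
    then show ?case by (intro truncate_norm_eq) auto
  qed
  then have "(\<lambda>n. truncate_norm (real (Suc n)) y) \<longlonglongrightarrow> y"
    by (rule tendsto_eventually)
  ultimately have "(\<lambda>n. cutoff (real (Suc n)) x *\<^sub>R truncate_norm (real (Suc n)) y) \<longlonglongrightarrow> max 0 (1 - 0) *\<^sub>R y"
    by (intro tendsto_intros)
  then show ?thesis by simp
qed

lemma borel_ae_limit_of_continuous:
  fixes f :: "'a::euclidean_space \<Rightarrow> 'b::euclidean_space"
  assumes "f \<in> borel_measurable borel"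
  obtains v :: "nat \<Rightarrow> 'a \<Rightarrow> 'b"
    where "\<And>n. continuous_on UNIV (v n)" "AE x in lborel. (\<lambda>n. v n x) \<longlonglongrightarrow> f x"
proof -
  have "f measurable_on UNIV"
    using assms by (intro lebesgue_measurable_imp_measurable_on measurable_completion) auto
  then obtain N v where N: "negligible N" and v: "\<And>n. continuous_on UNIV (v n)" "\<And>x. x \<notin> N \<Longrightarrow> (\<lambda>n. v n x) \<longlonglongrightarrow> f x"
    unfolding measurable_on_def by auto
  have "AE x in lebesgue. x \<notin> N"
    using N by (auto simp: negligible_iff_null_sets intro: AE_not_in)
  then have "AE x in lborel. x \<notin> N"
    by (simp add: AE_completion_iff)
  then have "AE x in lborel. (\<lambda>n. v n x) \<longlonglongrightarrow> f x"
    by eventually_elim (rule v)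
  with v(1) that show thesis by blast
qed

lemma tendsto_norm_powr_0:
  fixes X :: "nat \<Rightarrow> 'b::real_normed_vector"
  assumes "X \<longlonglongrightarrow> y" "p > 0"
  shows "(\<lambda>n. ennreal (norm (y - X n) powr p)) \<longlonglongrightarrow> 0"
proof -
  have "(\<lambda>n. norm (y - X n)) \<longlonglongrightarrow> 0"
    using assms(1) by (intro tendsto_norm_zero) (auto intro!: tendsto_eq_intros)
  from tendsto_powr2[OF this tendsto_const[of p]] have "(\<lambda>n. norm (y - X n) powr p) \<longlonglongrightarrow> 0"
    using assms(2) by auto
  then show ?thesis
    by (metis ennreal_0 tendsto_ennrealI)
qed

text \<open>
  Measurability makes \<open>f\<close> an almost everywhere limit of continuous functions, but without any
  domination.  Truncating values and support at a fixed level \<open>M\<close> is a continuous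
  operation that supplies a constant bound on a ball, so the argument first lets the level
  grow and then, at a fixed level, uses dominated convergence along the continuous functions.
\<close>

lemma Lp_dense_continuous:
  fixes f :: "'a::euclidean_space \<Rightarrow> 'b::euclidean_space"
  assumes f [measurable]: "f \<in> borel_measurable borel" and p: "p > 0"
    and fin: "(\<integral>\<^sup>+x. norm (f x) powr p \<partial>lborel) < \<infinity>" and t: "t > (0::real)"
  obtains v r where "continuous_on UNIV v" "\<And>x. norm x \<ge> r \<Longrightarrow> v x = 0"
    "(\<integral>\<^sup>+x. norm (f x - v x) powr p \<partial>lborel) < ennreal t"
proof -
  define s where "s = t / (2 * 2 powr p)"
  have s: "s > 0" "2 powr p * (s + s) = t"
    using t by (auto simp: s_def)
  have trunc_meas [measurable]: "truncate_norm (real (Suc n)) \<in> borel_measurable borel" for n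
    by (intro borel_measurable_continuous_onI continuous_on_truncate_norm) auto
  have cut_meas [measurable]: "cutoff (real (Suc n)) \<in> borel_measurable borel" for n
    by (intro borel_measurable_continuous_onI continuous_on_cutoff) auto
  define F :: "nat \<Rightarrow> 'a \<Rightarrow> 'b" where "F n x = cutoff (real (Suc n)) x *\<^sub>R truncate_norm (real (Suc n)) (f x)" for n x
  have F_meas [measurable]: "F n \<in> borel_measurable borel" for n
    unfolding F_def by measurable
  have "(\<lambda>n. \<integral>\<^sup>+x. norm (f x - F n x) powr p \<partial>lborel) \<longlonglongrightarrow> (\<integral>\<^sup>+(x::'a). 0 \<partial>lborel)"
  proof (rule nn_integral_dominated_convergence[where w = "\<lambda>x. ennreal (norm (f x) powr p)"])
    show "AE x in lborel. ennreal (norm (f x - F n x) powr p) \<le> ennreal (norm (f x) powr p)" for n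
      using p by (intro AE_I2 ennreal_leI powr_mono2) (auto simp: F_def intro!: norm_diff_truncate_le)
    show "AE x in lborel. (\<lambda>n. ennreal (norm (f x - F n x) powr p)) \<longlonglongrightarrow> 0"
      unfolding F_def using p by (intro AE_I2 tendsto_norm_powr_0 truncate_tendsto)
  qed (use fin in measurable)
  then have "\<forall>\<^sub>F n in sequentially. (\<integral>\<^sup>+x. norm (f x - F n x) powr p \<partial>lborel) < ennreal s"
    using s(1) by (intro order_tendstoD) auto
  then obtain n where n: "(\<integral>\<^sup>+x. norm (f x - F n x) powr p \<partial>lborel) < ennreal s"
    by (auto simp: eventually_sequentially)
  define M where "M = real (Suc n)"
  have M: "M > 0" by (simp add: M_def)
  obtain v :: "nat \<Rightarrow> 'a \<Rightarrow> 'b" where v: "\<And>k. continuous_on UNIV (v k)" "AE x in lborel. (\<lambda>k. v k x) \<longlonglongrightarrow> f x"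
    using borel_ae_limit_of_continuous[OF f] by blast
  define V :: "nat \<Rightarrow> 'a \<Rightarrow> 'b" where "V k x = cutoff M x *\<^sub>R truncate_norm M (v k x)" for k x
  have V_cont: "continuous_on UNIV (V k)" for k
    unfolding V_def using M
    by (intro continuous_intros continuous_on_cutoff continuous_on_compose2[OF continuous_on_truncate_norm[OF M] v(1)]) auto
  have V_meas [measurable]: "V k \<in> borel_measurable borel" for k
    using V_cont by (intro borel_measurable_continuous_onI)
  have "(\<lambda>k. \<integral>\<^sup>+x. norm (F n x - V k x) powr p \<partial>lborel) \<longlonglongrightarrow> (\<integral>\<^sup>+(x::'a). 0 \<partial>lborel)"
  proof (rule nn_integral_dominated_convergence[where w = "\<lambda>x. ennreal ((2 * M) powr p) * indicator (cball 0 M) x"])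
    show "AE x in lborel. ennreal (norm (F n x - V k x) powr p) \<le> ennreal ((2 * M) powr p) * indicator (cball 0 M) x" for k
    proof (intro AE_I2)
      fix x :: 'a
      have le: "norm (cutoff M x *\<^sub>R truncate_norm M y) \<le> M" for y :: 'b
      proof -
        have "\<bar>cutoff M x\<bar> * norm (truncate_norm M y) \<le> 1 * M"
          using cutoff_bounds[OF M, of x] norm_truncate_norm_le[OF M, of y] by (intro mult_mono) auto
        then show ?thesis by simp
      qed
      have "norm (F n x - V k x) \<le> 2 * M"
        using norm_triangle_ineq4[of "F n x" "V k x"] le[of "f x"] le[of "v k x"]
        by (simp add: F_def V_def M_def)
      moreover have "F n x - V k x = 0" if "x \<notin> cball 0 M"
        using that cutoff_eq_0[OF M, of x] by (simp add: F_def V_def M_def)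
      ultimately show "ennreal (norm (F n x - V k x) powr p) \<le> ennreal ((2 * M) powr p) * indicator (cball 0 M) x"
        using p by (cases "x \<in> cball 0 M") (auto intro!: ennreal_leI powr_mono2 simp: indicator_def)
    qed
    show "(\<lambda>x. ennreal (norm (F n x - V k x) powr p)) \<in> borel_measurable lborel" for k
      by measurable
    show "(\<lambda>x. ennreal ((2 * M) powr p) * indicator (cball (0::'a) M) x) \<in> borel_measurable lborel"
      by (intro borel_measurable_times_ennreal borel_measurable_const borel_measurable_indicator) simp
    show "AE x in lborel. (\<lambda>k. ennreal (norm (F n x - V k x) powr p)) \<longlonglongrightarrow> 0"
      using v(2)
    proof eventually_elim
      case (elim x)
      have "isCont (truncate_norm M) (f x)"
        using continuous_on_truncate_norm[OF M, of "UNIV :: 'b set"] by (simp add: continuous_on_eq_continuous_at)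
      from isCont_tendsto_compose[OF this elim]
      have "(\<lambda>k. V k x) \<longlonglongrightarrow> F n x"
        unfolding V_def F_def M_def[symmetric] by (intro tendsto_intros)
      then show ?case using p by (intro tendsto_norm_powr_0)
    qed
    show "(\<integral>\<^sup>+(x::'a). ennreal ((2 * M) powr p) * indicator (cball 0 M) x \<partial>lborel) < \<infinity>"
      using emeasure_bounded_finite[OF bounded_cball[of "0::'a" M]]
      by (simp add: nn_integral_cmult_indicator ennreal_mult_less_top)
  qed simp
  then have "\<forall>\<^sub>F k in sequentially. (\<integral>\<^sup>+x. norm (F n x - V k x) powr p \<partial>lborel) < ennreal s"
    using s(1) by (intro order_tendstoD) auto
  then obtain k where k: "(\<integral>\<^sup>+x. norm (F n x - V k x) powr p \<partial>lborel) < ennreal s"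
    by (auto simp: eventually_sequentially)
  have "(\<integral>\<^sup>+x. norm (f x - V k x) powr p \<partial>lborel)
      \<le> (\<integral>\<^sup>+x. ennreal (2 powr p) * (ennreal (norm (f x - F n x) powr p) + ennreal (norm (F n x - V k x) powr p)) \<partial>lborel)"
  proof (intro nn_integral_mono)
    fix x
    have "norm (f x - V k x) powr p \<le> (norm (f x - F n x) + norm (F n x - V k x)) powr p"
      using p norm_triangle_ineq[of "f x - F n x" "F n x - V k x"] by (intro powr_mono2) auto
    also have "\<dots> \<le> 2 powr p * (norm (f x - F n x) powr p + norm (F n x - V k x) powr p)"
      using p by (intro powr_add_le) auto
    finally show "ennreal (norm (f x - V k x) powr p) \<le> ennreal (2 powr p) * (ennreal (norm (f x - F n x) powr p) + ennreal (norm (F n x - V k x) powr p))"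
      by (simp add: ennreal_mult[symmetric] ennreal_plus[symmetric] del: ennreal_plus)
  qed
  also have "\<dots> = ennreal (2 powr p) * ((\<integral>\<^sup>+x. norm (f x - F n x) powr p \<partial>lborel) + (\<integral>\<^sup>+x. norm (F n x - V k x) powr p \<partial>lborel))"
    by (simp add: nn_integral_cmult nn_integral_add)
  also have "\<dots> < ennreal (2 powr p) * (ennreal s + ennreal s)"
    using add_strict_mono[OF n k] by (intro ennreal_mult_strict_left_mono) auto
  also have "\<dots> = ennreal t"
    using s by (simp add: ennreal_mult[symmetric] ennreal_plus[symmetric] del: ennreal_plus)
  finally show thesis
    using that[OF V_cont, of M k] M by (auto simp: V_def cutoff_eq_0)
qed

text \<open>
  Jensen's inequality for the probability density \<open>\<lambda>y. bump e (x - y)\<close>: integrate the tangent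
  inequality at \<open>b = norm (mollify e f x)\<close> in the variable \<open>norm (f y)\<close>.
\<close>

lemma norm_mollify_powr_le:
  fixes f :: "'a::euclidean_space \<Rightarrow> 'b::euclidean_space"
  assumes e: "e > 0" and p: "p > 1" and f: "integrable lborel f"
  shows "ennreal (norm (mollify e f x) powr p) \<le> (\<integral>\<^sup>+y. ennreal (bump e (x - y)) * ennreal (norm (f y) powr p) \<partial>lborel)"
proof (cases "(\<integral>\<^sup>+y. ennreal (bump e (x - y)) * ennreal (norm (f y) powr p) \<partial>lborel) < \<infinity>")
  case True
  have [measurable]: "f \<in> borel_measurable borel" using f by auto
  define b where "b = norm (mollify e f x)"
  have int: "integrable lborel (\<lambda>y. bump e (x - y) * norm (f y) powr p)"
    using True by (intro integrableI_bounded) (auto simp: abs_mult ennreal_mult bump_nonneg[OF e])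
  have int1: "integrable lborel (\<lambda>y. bump e (x - y) * norm (f y))"
    using integrable_norm[OF mollify_integrable[OF e f, of x]] by (simp add: bump_nonneg[OF e])
  have intb: "integrable lborel (\<lambda>y. bump e (x - y))"
    by (rule integrable_bump_diff[OF e])
  have ge: "b \<le> (LINT y|lborel. bump e (x - y) * norm (f y))"
    unfolding b_def mollify_def using integral_norm_bound[of lborel "\<lambda>y. bump e (x - y) *\<^sub>R f y"]
    by (simp add: bump_nonneg[OF e])
  have "b powr p \<le> b powr p + p * b powr (p - 1) * ((LINT y|lborel. bump e (x - y) * norm (f y)) - b)"
    using ge p by simp
  also have "\<dots> = (LINT y|lborel. bump e (x - y) * (b powr p - p * b powr (p - 1) * b) + p * b powr (p - 1) * (bump e (x - y) * norm (f y)))"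
    using intb int1 by (simp add: integral_bump_diff[OF e] right_diff_distrib)
  also have "\<dots> \<le> (LINT y|lborel. bump e (x - y) * norm (f y) powr p)"
  proof (rule integral_mono)
    fix y
    have "bump e (x - y) * (b powr p + p * b powr (p - 1) * (norm (f y) - b)) \<le> bump e (x - y) * norm (f y) powr p"
      using p by (intro mult_left_mono powr_tangent_le bump_nonneg[OF e]) (auto simp: b_def)
    then show "bump e (x - y) * (b powr p - p * b powr (p - 1) * b) + p * b powr (p - 1) * (bump e (x - y) * norm (f y))
        \<le> bump e (x - y) * norm (f y) powr p"
      by (simp add: algebra_simps)
  qed (use int intb int1 in auto)
  finally have "ennreal (b powr p) \<le> ennreal (LINT y|lborel. bump e (x - y) * norm (f y) powr p)"
    by (rule ennreal_leI)
  also have "\<dots> = (\<integral>\<^sup>+y. ennreal (bump e (x - y)) * ennreal (norm (f y) powr p) \<partial>lborel)"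
  proof -
    have "(\<integral>\<^sup>+y. ennreal (bump e (x - y) * norm (f y) powr p) \<partial>lborel) = ennreal (LINT y|lborel. bump e (x - y) * norm (f y) powr p)"
      using int by (rule nn_integral_eq_integral) (simp add: bump_nonneg[OF e])
    then show ?thesis
      by (simp add: ennreal_mult bump_nonneg[OF e])
  qed
  finally show ?thesis by (simp add: b_def)
qed (simp add: less_top[symmetric])

text \<open>
  Mollification is a contraction in \<open>L\<^sup>p\<close>: Jensen's inequality, then Tonelli's theorem.
\<close>

lemma nn_integral_mollify_powr_le:
  fixes f :: "'a::euclidean_space \<Rightarrow> 'b::euclidean_space"
  assumes e: "e > 0" and p: "p > 1" and f: "integrable lborel f"
  shows "(\<integral>\<^sup>+x. norm (mollify e f x) powr p \<partial>lborel) \<le> (\<integral>\<^sup>+x. norm (f x) powr p \<partial>lborel)"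
proof -
  have [measurable]: "f \<in> borel_measurable borel" using f by auto
  have "(\<integral>\<^sup>+x. norm (mollify e f x) powr p \<partial>lborel)
     \<le> (\<integral>\<^sup>+x. \<integral>\<^sup>+y. ennreal (bump e (x - y)) * ennreal (norm (f y) powr p) \<partial>lborel \<partial>lborel)"
    by (intro nn_integral_mono norm_mollify_powr_le assms)
  also have "\<dots> = (\<integral>\<^sup>+y. \<integral>\<^sup>+x. ennreal (bump e (x - y)) * ennreal (norm (f y) powr p) \<partial>lborel \<partial>lborel)"
    by (rule lborel_pair.Fubini') measurable
  also have "\<dots> = (\<integral>\<^sup>+y. norm (f y) powr p \<partial>lborel)"
    by (simp add: nn_integral_multc nn_integral_bump_diff[OF e])
  finally show ?thesis .
qed

lemma norm_mollify_diff_le: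
  fixes f :: "'a::euclidean_space \<Rightarrow> 'b::euclidean_space"
  assumes e: "e > 0" and f: "integrable lborel f"
    and close: "\<And>y. norm (x - y) < e \<Longrightarrow> norm (f y - f x) \<le> t"
  shows "norm (mollify e f x - f x) \<le> t"
proof -
  have intb: "integrable lborel (\<lambda>y. bump e (x - y))"
    by (rule integrable_bump_diff[OF e])
  have eq: "mollify e f x - f x = (LINT y|lborel. bump e (x - y) *\<^sub>R (f y - f x))"
    using mollify_integrable[OF e f, of x] intb integral_bump_diff[OF e, of x]
    by (simp add: mollify_def scaleR_diff_right)
  have "norm (LINT y|lborel. bump e (x - y) *\<^sub>R (f y - f x)) \<le> (LINT y|lborel. bump e (x - y) * t)"
  proof (rule Bochner_Integration.integral_norm_bound_integral)
    show "norm (bump e (x - y) *\<^sub>R (f y - f x)) \<le> bump e (x - y) * t" for y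
      using close[of y] bump_eq_0[OF e, of "x - y"] bump_nonneg[OF e, of "x - y"]
      by (cases "norm (x - y) < e") (auto intro: mult_left_mono)
  qed (use mollify_integrable[OF e f, of x] intb in \<open>auto simp: scaleR_diff_right\<close>)
  then show ?thesis
    unfolding eq using intb integral_bump_diff[OF e, of x] by simp
qed

lemma mollify_uniform:
  fixes f :: "'a::euclidean_space \<Rightarrow> 'b::euclidean_space"
  assumes f: "integrable lborel f" and S: "compact S" "continuous_on S f"
    and r: "r > 0" "\<And>x. x \<in> K \<Longrightarrow> cball x r \<subseteq> S" and t: "t > 0"
  shows "\<forall>\<^sub>F e in at_right 0. \<forall>x\<in>K. norm (mollify e f x - f x) \<le> t"
proof -
  have "uniformly_continuous_on S f"
    using compact_uniformly_continuous S by blast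
  then obtain d where d: "d > 0" "\<And>x y. x \<in> S \<Longrightarrow> y \<in> S \<Longrightarrow> dist y x < d \<Longrightarrow> dist (f y) (f x) < t"
    unfolding uniformly_continuous_on_def using t by metis
  have "\<forall>\<^sub>F e in at_right 0. e < d" "\<forall>\<^sub>F e in at_right 0. e < r" and "\<forall>\<^sub>F e in at_right 0. e > (0::real)"
    using d(1) r(1) by (auto intro!: eventually_at_right_less order_tendstoD(2)[OF tendsto_ident_at])
  then show ?thesis
  proof eventually_elim
    case (elim e)
    show ?case
    proof
      fix x assume x: "x \<in> K"
      show "norm (mollify e f x - f x) \<le> t"
      proof (rule norm_mollify_diff_le[OF elim(3) f])
        fix y assume y: "norm (x - y) < e"
        then have "y \<in> S" "x \<in> S" "dist y x < d"
          using elim(1,2) r(1) r(2)[OF x] by (auto simp: dist_norm norm_minus_commute subset_iff)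
        then have "dist (f y) (f x) < t" using d(2) by blast
        then show "norm (f y - f x) \<le> t" by (simp add: dist_norm)
      qed
    qed
  qed
qed

text \<open>
  Approximate \<open>f\<close> in \<open>L\<^sup>p\<close> by a continuous \<open>v\<close>.  The difference \<open>f - v\<close> stays small under
  mollification by the contraction property, and mollifications of \<open>v\<close> converge uniformly on \<open>K\<close>.
\<close>

lemma mollify_Lp:
  fixes f :: "'a::euclidean_space \<Rightarrow> 'b::euclidean_space"
  assumes p: "p > 1" and f: "integrable lborel f"
    and fin: "(\<integral>\<^sup>+x. norm (f x) powr p \<partial>lborel) < \<infinity>" and K: "compact K" and t: "t > (0::real)"
  shows "\<forall>\<^sub>F e in at_right 0. (\<integral>\<^sup>+x\<in>K. norm (mollify e f x - f x) powr p \<partial>lborel) \<le> t"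
proof -
  have [measurable]: "f \<in> borel_measurable borel" using f by auto
  have Kb: "K \<in> sets borel" using K by (simp add: compact_imp_closed)
  define m where "m = measure lborel K"
  have m: "emeasure lborel K = ennreal m" "m \<ge> 0"
    using emeasure_compact_finite[OF K] by (auto simp: m_def emeasure_eq_ennreal_measure top.not_eq_extremum)
  \<comment> \<open>Splitting a sum of three terms costs two applications of \<open>powr_add_le\<close>.\<close>
  define C where "C = 2 powr p * (2 powr p)"
  have C: "C > 0" by (simp add: C_def)
  define s where "s = t / (C * 3)"
  have s: "s > 0" using t C by (simp add: s_def)
  \<comment> \<open>A uniform error of this size contributes at most \<open>s\<close> to the integral over \<open>K\<close>; the added \<open>1\<close> covers null sets \<open>K\<close>.\<close>
  define h where "h = (s / (m + 1)) powr (1 / p)"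
  have h: "h > 0" "h powr p * m \<le> s"
    using s m(2) p by (auto simp: h_def powr_powr field_simps)
  obtain v r where v: "continuous_on UNIV v" "\<And>x. norm x \<ge> r \<Longrightarrow> v x = 0"
    "(\<integral>\<^sup>+x. norm (f x - v x) powr p \<partial>lborel) < ennreal s"
    using Lp_dense_continuous[of f p s] fin p s by auto
  have [measurable]: "v \<in> borel_measurable borel"
    using v(1) by (rule borel_measurable_continuous_onI)
  have vint: "integrable lborel v"
    using v(2) by (intro integrable_continuous_compact_support[OF v(1) compact_cball[of 0 r]]) auto
  obtain a where a: "\<And>x. x \<in> K \<Longrightarrow> norm x \<le> a"
    using compact_imp_bounded[OF K] bounded_iff by metis
  have "\<forall>\<^sub>F e in at_right 0. \<forall>x\<in>K. norm (mollify e v x - v x) \<le> h"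
  proof (rule mollify_uniform[OF vint compact_cball[of 0 "a + 1"], where r = 1])
    show "cball x 1 \<subseteq> cball 0 (a + 1)" if "x \<in> K" for x
      using a[OF that] by (auto simp: dist_norm) (smt (verit) norm_triangle_ineq4 norm_minus_commute norm_triangle_ineq2)
  qed (use v(1) h in \<open>auto intro: continuous_on_subset\<close>)
  moreover have "\<forall>\<^sub>F e in at_right 0. e > (0::real)"
    by (rule eventually_at_right_less)
  ultimately show ?thesis
  proof eventually_elim
    case (elim e)
    have fv: "integrable lborel (\<lambda>x. f x - v x)" using f vint by simp
    have [measurable]: "mollify e v \<in> borel_measurable borel" "mollify e (\<lambda>x. f x - v x) \<in> borel_measurable borel"
      using continuous_on_mollify[OF elim(2)] vint fv by (auto intro: borel_measurable_continuous_onI)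
    have lin: "mollify e (\<lambda>x. f x - v x) x = mollify e f x - mollify e v x" for x
      using mollify_integrable[OF elim(2) f, of x] mollify_integrable[OF elim(2) vint, of x]
      by (simp add: mollify_def scaleR_diff_right)
    have "(\<integral>\<^sup>+x\<in>K. norm (mollify e f x - f x) powr p \<partial>lborel)
      \<le> (\<integral>\<^sup>+x. ennreal C * (ennreal (norm (mollify e (\<lambda>x. f x - v x) x) powr p) + ennreal (norm (f x - v x) powr p) + ennreal (h powr p) * indicator K x) \<partial>lborel)"
    proof (intro nn_integral_mono)
      fix x
      show "ennreal (norm (mollify e f x - f x) powr p) * indicator K x \<le> 
         ennreal C * (ennreal (norm (mollify e (\<lambda>x. f x - v x) x) powr p) + ennreal (norm (f x - v x) powr p) + ennreal (h powr p) * indicator K x)"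
      proof (cases "x \<in> K")
        case True
        define A where "A = norm (mollify e (\<lambda>x. f x - v x) x)"
        define B where "B = norm (f x - v x)"
        have "norm (mollify e f x - f x) \<le> A + (B + h)"
        proof -
          have "mollify e f x - f x = mollify e (\<lambda>x. f x - v x) x + (- (f x - v x) + (mollify e v x - v x))"
            by (simp add: lin)
          also have "norm \<dots> \<le> A + (norm (- (f x - v x)) + norm (mollify e v x - v x))"
            unfolding A_def by (intro order_trans[OF norm_triangle_ineq] add_mono order_refl norm_triangle_ineq)
          also have "\<dots> \<le> A + (B + h)"
            using elim(1) True by (auto simp: B_def norm_minus_commute)
          finally show ?thesis .
        qed
        then have "norm (mollify e f x - f x) powr p \<le> (A + (B + h)) powr p"
          using p by (intro powr_mono2) auto
        also have "\<dots> \<le> 2 powr p * (A powr p + (B + h) powr p)"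
          using p h by (intro powr_add_le) (auto simp: A_def B_def)
        also have "\<dots> \<le> 2 powr p * (2 powr p * A powr p + 2 powr p * (B powr p + h powr p))"
          using p h by (intro mult_left_mono add_mono powr_add_le) (auto simp: A_def B_def mult_le_cancel_right1 ge_one_powr_ge_zero)
        also have "\<dots> = C * (A powr p + B powr p + h powr p)"
          by (simp add: C_def algebra_simps)
        finally show ?thesis
          using True C by (simp add: A_def B_def ennreal_mult[symmetric] ennreal_plus[symmetric] del: ennreal_plus)
      qed auto
    qed
    also have "\<dots> = ennreal C * ((\<integral>\<^sup>+x. norm (mollify e (\<lambda>x. f x - v x) x) powr p \<partial>lborel) + (\<integral>\<^sup>+x. norm (f x - v x) powr p \<partial>lborel) + ennreal (h powr p) * emeasure lborel K)"
      using Kb by (simp add: nn_integral_cmult nn_integral_add nn_integral_cmult_indicator)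
    also have "\<dots> \<le> ennreal C * (ennreal s + ennreal s + ennreal s)"
    proof (intro mult_left_mono add_mono)
      show "(\<integral>\<^sup>+x. norm (f x - v x) powr p \<partial>lborel) \<le> ennreal s"
        using v(3) by simp
      then show "(\<integral>\<^sup>+x. norm (mollify e (\<lambda>x. f x - v x) x) powr p \<partial>lborel) \<le> ennreal s"
        using nn_integral_mollify_powr_le[OF elim(2) p fv] by simp
      show "ennreal (h powr p) * emeasure lborel K \<le> ennreal s"
        using h m by (simp add: ennreal_mult[symmetric] ennreal_leI)
    qed auto
    also have "\<dots> = ennreal t"
      using s C by (simp add: ennreal_mult[symmetric] ennreal_plus[symmetric] s_def del: ennreal_plus)
    finally show ?case .
  qed
qed

section \<open>Integration by parts for test functions\<close>

lemma compact_closed_neighbourhood: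
  fixes K :: "'a::euclidean_space set"
  assumes "compact K" "open \<Omega>" "K \<subseteq> \<Omega>"
  obtains r S where "r > 0" "compact S" "S \<subseteq> \<Omega>" "\<And>x. x \<in> K \<Longrightarrow> cball x r \<subseteq> S"
proof -
  obtain r where r: "r > 0" "(\<Union>x\<in>K. cball x r) \<subseteq> \<Omega>"
    using compact_subset_open_imp_cball_epsilon_subset[OF assms] by blast
  define S where "S = {x + y | x y. x \<in> K \<and> y \<in> cball 0 r}"
  have S: "S = (\<Union>x\<in>K. cball x r)"
  proof (intro set_eqI iffI)
    fix z assume "z \<in> (\<Union>x\<in>K. cball x r)"
    then obtain x where x: "x \<in> K" "dist x z \<le> r" by auto
    then have "z = x + (z - x)" "z - x \<in> cball 0 r" by (auto simp: dist_norm norm_minus_commute)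
    with x(1) show "z \<in> S" unfolding S_def by blast
  next
    fix z assume "z \<in> S"
    then obtain x y where "z = x + y" "x \<in> K" "norm y \<le> r" by (auto simp: S_def)
    then show "z \<in> (\<Union>x\<in>K. cball x r)" by (intro UN_I[of x]) (auto simp: dist_norm)
  qed
  show thesis
  proof (rule that[of r S])
    show "compact S"
      unfolding S_def by (intro compact_sums assms(1) compact_cball)
  qed (use r S in auto)
qed

lemma test_function_eq_0:
  assumes "test_function \<Omega> \<phi> \<psi>" "x \<notin> closure {x. \<phi> x \<noteq> 0}"
  shows "\<phi> x = 0" "\<psi> x = 0"
proof -
  let ?S = "- closure {x. \<phi> x \<noteq> 0}"
  have z: "\<phi> y = 0" if "y \<in> ?S" for y
    using that closure_subset[of "{x. \<phi> x \<noteq> 0}"] by auto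
  have x: "x \<in> ?S" using assms(2) by simp
  show "\<phi> x = 0" by (rule z[OF x])
  have "GDERIV \<phi> x :> 0"
    by (rule GDERIV_transform_open[OF GDERIV_const[where k = 0] _ x z[symmetric]]) auto
  moreover have "GDERIV \<phi> x :> \<psi> x"
    using assms(1) by (simp add: test_function_def)
  ultimately have "(\<lambda>h. h \<bullet> \<psi> x) = (\<lambda>h. h \<bullet> 0)"
    unfolding gderiv_def by (rule has_derivative_unique[rotated])
  then have "\<psi> x \<bullet> \<psi> x = \<psi> x \<bullet> 0" by metis
  then show "\<psi> x = 0" by simp
qed

lemma GDERIV_imp_continuous_on: "(\<And>x. x \<in> S \<Longrightarrow> GDERIV f x :> D x) \<Longrightarrow> continuous_on S f"
  unfolding gderiv_def
  by (intro continuous_at_imp_continuous_on ballI has_derivative_continuous)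

text \<open>
  Translation invariance: all difference quotients of \<open>F\<close> in direction \<open>e\<close> have integral zero.
  They are bounded by a common multiple of the indicator of a ball, so the integral of the
  derivative is zero too.
\<close>

lemma integral_gradient_inner_eq_0:
  assumes tf: "test_function \<Omega> F G"
  shows "(LINT x|lborel. G x \<bullet> e) = 0"
proof -
  define K where "K = closure {x. F x \<noteq> 0}"
  have K: "compact K" and d: "\<And>x. GDERIV F x :> G x" and Gc: "continuous_on UNIV G"
    using tf by (auto simp: test_function_def K_def)
  have z: "F x = 0" "G x = 0" if "x \<notin> K" for x
    using test_function_eq_0[OF tf that[unfolded K_def]] .
  have Fc: "continuous_on UNIV F" using d by (rule GDERIV_imp_continuous_on)
  have [measurable]: "F \<in> borel_measurable borel" "G \<in> borel_measurable borel"
    using Fc Gc by (auto intro: borel_measurable_continuous_onI)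
  have Fint: "integrable lborel F"
    by (rule integrable_continuous_compact_support[OF Fc K z(1)])
  obtain B where B: "B > 0" "\<And>x. norm (G x) \<le> B"
    using bounded_continuous_compact_support[OF Gc K z(2)] by blast
  obtain a where a: "\<And>x. x \<in> K \<Longrightarrow> norm x \<le> a"
    using compact_imp_bounded[OF K] bounded_iff by metis
  have lip: "\<bar>F (x + h) - F x\<bar> \<le> B * norm h" for x h
  proof -
    have "norm (F (x + h) - F x) \<le> B * norm (x + h - x)"
    proof (rule differentiable_bound[where S = UNIV and f' = "\<lambda>x h. h \<bullet> G x"])
      show "onorm (\<lambda>h. h \<bullet> G x) \<le> B" for x
        using B(2)[of x] by (intro onorm_le) (smt (verit, ccfv_SIG) Cauchy_Schwarz_ineq2 mult.commute mult_right_mono norm_ge_zero real_norm_def)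
    qed (use d in \<open>auto simp: gderiv_def\<close>)
    then show ?thesis by simp
  qed
  define s where "s n = inverse (real (Suc n))" for n
  have s: "s n > 0" "s n \<le> 1" for n by (auto simp: s_def field_simps)
  \<comment> \<open>Difference quotients along \<open>e\<close>; steps of size at most \<open>1\<close> keep their supports in a common ball.\<close>
  define q where "q n x = (F (x + s n *\<^sub>R e) - F x) / s n" for n x
  have "(\<lambda>n. LINT x|lborel. q n x) \<longlonglongrightarrow> (LINT x|lborel. G x \<bullet> e)"
  proof (rule integral_dominated_convergence[where w = "\<lambda>x. indicator (cball 0 (a + norm e)) x *\<^sub>R (B * norm e)"])
    show "AE x in lborel. norm (q n x) \<le> indicator (cball 0 (a + norm e)) x *\<^sub>R (B * norm e)" for n
    proof (intro AE_I2)
      fix x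
      have *: "norm (s n *\<^sub>R e) \<le> norm e"
        using s[of n] by (simp add: mult_left_le_one_le)
      have "q n x = 0" if "x \<notin> cball 0 (a + norm e)"
      proof -
        have n: "norm x > a + norm e" using that by simp
        then have "x \<notin> K" using a[of x] norm_ge_zero[of e] by linarith
        moreover have "norm x \<le> norm (x + s n *\<^sub>R e) + norm (s n *\<^sub>R e)"
          using norm_triangle_ineq4[of "x + s n *\<^sub>R e" "s n *\<^sub>R e"] by simp
        then have "x + s n *\<^sub>R e \<notin> K"
          using n a[of "x + s n *\<^sub>R e"] * by linarith
        ultimately have "x \<notin> K" "x + s n *\<^sub>R e \<notin> K" by auto
        then show ?thesis by (simp add: q_def z)
      qed
      moreover have "norm (q n x) \<le> B * norm e"
        using lip[of x "s n *\<^sub>R e"] s[of n] by (simp add: q_def divide_le_eq mult.assoc mult.commute mult.left_commute)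
      ultimately show "norm (q n x) \<le> indicator (cball 0 (a + norm e)) x *\<^sub>R (B * norm e)"
        by (auto simp: indicator_def)
    qed
    show "integrable lborel (\<lambda>x::'a. indicator (cball 0 (a + norm e)) x *\<^sub>R (B * norm e))"
      using borel_integrable_compact[OF compact_cball, of "0::'a" "a + norm e" "\<lambda>_. B * norm e"] by simp
    show "AE x in lborel. (\<lambda>n. q n x) \<longlonglongrightarrow> G x \<bullet> e"
    proof (intro AE_I2)
      fix x
      have "((\<lambda>t. F (x + t *\<^sub>R e)) has_derivative (\<lambda>t. (t *\<^sub>R e) \<bullet> G (x + 0 *\<^sub>R e))) (at 0)"
      proof (rule has_derivative_compose[where f = "\<lambda>t. x + t *\<^sub>R e" and g = F])
        show "((\<lambda>t. x + t *\<^sub>R e) has_derivative (\<lambda>t. t *\<^sub>R e)) (at 0)"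
          by (auto intro!: derivative_eq_intros)
      qed (use d in \<open>auto simp: gderiv_def\<close>)
      moreover have "(\<lambda>t. (t *\<^sub>R e) \<bullet> G (x + 0 *\<^sub>R e)) = (*) (G x \<bullet> e)"
        by (auto simp: inner_commute)
      ultimately have "((\<lambda>t. F (x + t *\<^sub>R e)) has_field_derivative (G x \<bullet> e)) (at 0)"
        by (simp only: has_field_derivative_def)
      then have "((\<lambda>t. (F (x + t *\<^sub>R e) - F x) / t) \<longlongrightarrow> G x \<bullet> e) (at 0)"
        by (simp add: DERIV_def)
      moreover have "filterlim s (at 0) sequentially"
        unfolding filterlim_at s_def using LIMSEQ_inverse_real_of_nat by auto
      ultimately show "(\<lambda>n. q n x) \<longlonglongrightarrow> G x \<bullet> e"
        unfolding q_def by (rule filterlim_compose)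
    qed
  qed (auto simp: q_def)
  moreover have "(LINT x|lborel. q n x) = 0" for n
    using Fint integral_lborel_translate[of F "s n *\<^sub>R e"]
    by (simp add: q_def)
  ultimately show ?thesis
    by (simp add: LIMSEQ_const_iff)
qed

text \<open>
  The divergence theorem for the field \<open>F x *\<^sub>R x\<close>, whose divergence is \<open>G x \<bullet> x + N F x\<close>.  This identity
  is the only form of integration by parts that the comparison argument uses.
\<close>

lemma integral_gradient_inner_position:
  fixes F :: "'a::euclidean_space \<Rightarrow> real"
  assumes tf: "test_function \<Omega> F G"
  shows "(LINT x|lborel. G x \<bullet> x) = - real DIM('a) * (LINT x|lborel. F x)"
proof -
  define K where "K = closure {x. F x \<noteq> 0}"
  have K: "compact K" "K \<subseteq> \<Omega>" and d: "\<And>x. GDERIV F x :> G x" and Gc: "continuous_on UNIV G"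
    using tf by (auto simp: test_function_def K_def)
  have z: "F x = 0" "G x = 0" if "x \<notin> K" for x
    using test_function_eq_0[OF tf that[unfolded K_def]] .
  have Fc: "continuous_on UNIV F" using d by (rule GDERIV_imp_continuous_on)
  have Fint: "integrable lborel F"
    by (rule integrable_continuous_compact_support[OF Fc K(1) z(1)])
  have int: "integrable lborel (\<lambda>x. (x \<bullet> e) * (G x \<bullet> e))" for e
    using Gc z by (intro integrable_continuous_compact_support[OF _ K(1)] continuous_intros) auto
  have zero: "(LINT x|lborel. (x \<bullet> e) * (G x \<bullet> e)) = - (LINT x|lborel. F x)" if "e \<in> Basis" for e
  proof -
    have sub: "closure {x. (x \<bullet> e) * F x \<noteq> 0} \<subseteq> K"
      unfolding K_def by (intro closure_mono) auto
    have "test_function \<Omega> (\<lambda>x. (x \<bullet> e) * F x) (\<lambda>x. (x \<bullet> e) *\<^sub>R G x + F x *\<^sub>R e)"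
      unfolding test_function_def
    proof (intro conjI allI)
      show "GDERIV (\<lambda>x. (x \<bullet> e) * F x) x :> (x \<bullet> e) *\<^sub>R G x + F x *\<^sub>R e" for x
        by (rule GDERIV_mult[OF GDERIV_inner_const d])
      show "continuous_on UNIV (\<lambda>x. (x \<bullet> e) *\<^sub>R G x + F x *\<^sub>R e)"
        by (intro continuous_intros Gc Fc)
      show "compact (closure {x. (x \<bullet> e) * F x \<noteq> 0})"
        using compact_Int_closed[OF K(1) closed_closure, of "{x. (x \<bullet> e) * F x \<noteq> 0}"] sub
        by (simp add: Int_absorb1)
      show "closure {x. (x \<bullet> e) * F x \<noteq> 0} \<subseteq> \<Omega>"
        using sub K(2) by blast
    qed
    from integral_gradient_inner_eq_0[OF this, of e]
    have "(LINT x|lborel. (x \<bullet> e) * (G x \<bullet> e) + F x) = 0"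
      using that by (simp add: inner_add_left)
    then show ?thesis
      using int Fint by simp
  qed
  have "(LINT x|lborel. G x \<bullet> x) = (LINT x|lborel. (\<Sum>e\<in>Basis. (x \<bullet> e) * (G x \<bullet> e)))"
    by (subst euclidean_inner) (simp add: mult.commute)
  also have "\<dots> = (\<Sum>e\<in>(Basis::'a set). LINT x|lborel. (x \<bullet> e) * (G x \<bullet> e))"
    using int by (intro Bochner_Integration.integral_sum) auto
  also have "\<dots> = - real DIM('a) * (LINT x|lborel. F x)"
    using zero by simp
  finally show ?thesis .
qed

section \<open>Smooth approximation of weakly differentiable functions\<close>

lemma lebesgue_borel_representative:
  fixes f :: "'a::euclidean_space \<Rightarrow> 'b::euclidean_space"
  assumes "f \<in> borel_measurable lebesgue"
  obtains g where "g \<in> borel_measurable borel" "AE x in lebesgue. f x = g x"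
proof -
  have "\<exists>h. h \<in> borel_measurable borel \<and> (AE x in lebesgue. f x \<bullet> i = h x)" for i
    using completion_ex_borel_measurable_real[of "\<lambda>x. f x \<bullet> i" lborel] assms
    by (auto simp: AE_completion_iff)
  then obtain h where h: "\<And>i. h i \<in> borel_measurable borel" "\<And>i. AE x in lebesgue. f x \<bullet> i = h i x"
    by metis
  have [measurable]: "h i \<in> borel_measurable borel" for i by (rule h)
  show thesis
  proof
    show "(\<lambda>x. \<Sum>i\<in>Basis. h i x *\<^sub>R i) \<in> borel_measurable borel"
      by measurable
    have "AE x in lebesgue. \<forall>i\<in>Basis. f x \<bullet> i = h i x"
      using h(2) by (intro AE_finite_allI) auto
    then show "AE x in lebesgue. f x = (\<Sum>i\<in>Basis. h i x *\<^sub>R i)"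
    proof eventually_elim
      case (elim x)
      then have "(\<Sum>i\<in>Basis. h i x *\<^sub>R i) = (\<Sum>i\<in>Basis. (f x \<bullet> i) *\<^sub>R i)"
        by (intro sum.cong) auto
      then show ?case by (simp add: euclidean_representation)
    qed
  qed
qed

lemma Lp_loc_cong_AE:
  fixes f g :: "'a::euclidean_space \<Rightarrow> 'b::euclidean_space"
  assumes f: "Lp_loc r \<Omega> f" and g: "g \<in> borel_measurable lebesgue" and \<Omega>: "open \<Omega>"
    and ae: "AE x in lebesgue. x \<in> \<Omega> \<longrightarrow> f x = g x"
  shows "Lp_loc r \<Omega> g"
  unfolding Lp_loc_def
proof (intro conjI allI impI)
  have [measurable]: "\<Omega> \<in> sets lebesgue" using \<Omega> by auto
  note g[measurable]
  show "set_borel_measurable lebesgue \<Omega> g"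
    unfolding set_borel_measurable_def by measurable
  fix K assume K: "compact K \<and> K \<subseteq> \<Omega>"
  have [measurable]: "K \<in> sets lebesgue" using K by (simp add: compact_imp_closed)
  have int: "integrable lebesgue (\<lambda>x. indicator K x *\<^sub>R norm (f x) powr r)"
    using f K by (auto simp: Lp_loc_def set_integrable_def)
  have "integrable lebesgue (\<lambda>x. indicator K x *\<^sub>R norm (g x) powr r)"
  proof (rule integrable_cong_AE_imp[OF int])
    show "AE x in lebesgue. indicator K x *\<^sub>R norm (f x) powr r = indicator K x *\<^sub>R norm (g x) powr r"
      using ae by eventually_elim (use K in \<open>auto simp: indicator_def\<close>)
  qed measurable
  then show "set_integrable lebesgue K (\<lambda>x. norm (g x) powr r)"
    by (simp add: set_integrable_def)
qed

text \<open>
  Changing the gradient on a null set makes it Borel measurable, so that Tonelli's theorem for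
  the product of two Borel measures applies to its mollifications.
\<close>

lemma W1p_loc_borel_gradient:
  fixes u :: "'a::euclidean_space \<Rightarrow> real"
  assumes u: "W1p_loc r \<Omega> u" and \<Omega>: "open \<Omega>"
  obtains g where "g \<in> borel_measurable borel" "has_weak_gradient \<Omega> u g" "Lp_loc r \<Omega> g"
proof -
  obtain f where f: "has_weak_gradient \<Omega> u f" "Lp_loc r \<Omega> f"
    using u by (auto simp: W1p_loc_def)
  have m: "(\<lambda>x. indicator \<Omega> x *\<^sub>R f x) \<in> borel_measurable lebesgue"
    using f(2) by (simp add: Lp_loc_def set_borel_measurable_def)
  obtain g where g: "g \<in> borel_measurable borel" "AE x in lebesgue. indicator \<Omega> x *\<^sub>R f x = g x"
    using lebesgue_borel_representative[OF m] by blast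
  have gl [measurable]: "g \<in> borel_measurable lebesgue"
    using g(1) by (intro measurable_completion) simp
  have [measurable]: "\<Omega> \<in> sets lebesgue" using \<Omega> by auto
  have ae: "AE x in lebesgue. x \<in> \<Omega> \<longrightarrow> f x = g x"
    using g(2) by eventually_elim auto
  have "(LINT x:\<Omega>|lebesgue. \<phi> x *\<^sub>R f x) = (LINT x:\<Omega>|lebesgue. \<phi> x *\<^sub>R g x)"
    if "test_function \<Omega> \<phi> \<psi>" for \<phi> \<psi>
  proof -
    have "continuous_on UNIV \<phi>"
      by (rule GDERIV_imp_continuous_on) (use that in \<open>auto simp: test_function_def\<close>)
    then have "\<phi> \<in> borel_measurable lebesgue"
      by (intro measurable_completion) (auto intro: borel_measurable_continuous_onI)
    note [measurable] = this m
    have "(\<lambda>x. \<phi> x *\<^sub>R (indicator \<Omega> x *\<^sub>R f x)) \<in> borel_measurable lebesgue"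
      by measurable
    moreover have "(\<lambda>x. \<phi> x *\<^sub>R (indicator \<Omega> x *\<^sub>R f x)) = (\<lambda>x. indicator \<Omega> x *\<^sub>R (\<phi> x *\<^sub>R f x))"
      by (auto simp: mult.commute)
    ultimately show ?thesis
      unfolding set_lebesgue_integral_def
      using ae by (intro integral_cong_AE) (auto elim!: eventually_mono simp: indicator_def)
  qed
  then have "has_weak_gradient \<Omega> u g"
    using f(1) Lp_loc_cong_AE[OF _ gl \<Omega> ae] by (auto simp: has_weak_gradient_def)
  with that g(1) Lp_loc_cong_AE[OF f(2) gl \<Omega> ae] show thesis by blast
qed

lemma test_function_bump:
  assumes e: "e > 0" and sub: "cball x e \<subseteq> \<Omega>"
  shows "test_function \<Omega> (\<lambda>y. bump e (y - x)) (\<lambda>y. bump_grad e (y - x))"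
  unfolding test_function_def
proof (intro conjI allI)
  show "GDERIV (\<lambda>y. bump e (y - x)) y :> bump_grad e (y - x)" for y
    using GDERIV_bump[of e "y - x"] unfolding gderiv_def
    by (intro has_derivative_compose[where f = "\<lambda>y. y - x" and g = "bump e", of "\<lambda>h. h", simplified])
      (auto intro!: derivative_eq_intros)
  show "continuous_on UNIV (\<lambda>y. bump_grad e (y - x))"
    by (intro continuous_on_compose2[OF continuous_on_bump_grad[of UNIV]] continuous_intros) auto
  have "{y. bump e (y - x) \<noteq> 0} \<subseteq> cball x e"
    using bump_eq_0[OF e] by (force simp: dist_norm norm_minus_commute)
  then have cl: "closure {y. bump e (y - x) \<noteq> 0} \<subseteq> cball x e"
    by (rule closure_minimal) simp
  show "compact (closure {y. bump e (y - x) \<noteq> 0})"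
    using compact_Int_closed[OF compact_cball closed_closure, of x e "{y. bump e (y - x) \<noteq> 0}"] cl
    by (simp add: Int_absorb1)
  show "closure {y. bump e (y - x) \<noteq> 0} \<subseteq> \<Omega>"
    using cl sub by blast
qed

text \<open>
  Extend \<open>u\<close> and \<open>g\<close> by zero outside a compact neighbourhood \<open>S\<close> of \<open>K\<close> and mollify at scales
  so small that the kernel, translated to a point of \<open>K\<close>, is supported in \<open>S\<close>.  It is then an
  admissible test function for the weak gradient, and testing with it shows that on \<open>K\<close> the gradient of the mollified \<open>u\<close> is the mollified \<open>g\<close>.
\<close>

lemma local_smooth_approximation:
  fixes u :: "'a::euclidean_space \<Rightarrow> real"
  assumes p: "p > 1" and \<Omega>: "open \<Omega>" and u: "continuous_on \<Omega> u"
    and g: "g \<in> borel_measurable borel" "has_weak_gradient \<Omega> u g" "Lp_loc p \<Omega> g"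
    and K: "compact K" "K \<subseteq> \<Omega>"
  obtains v h where "\<And>n x. x \<in> K \<Longrightarrow> GDERIV (v n) x :> h n x" "\<And>n. continuous_on UNIV (v n)"
    "\<And>n. continuous_on UNIV (h n)" "uniform_limit K v u sequentially"
    "(\<lambda>n. \<integral>\<^sup>+x\<in>K. norm (h n x - g x) powr p \<partial>lborel) \<longlonglongrightarrow> 0"
proof -
  obtain r S where r: "r > 0" and S: "compact S" "S \<subseteq> \<Omega>" and sub: "\<And>x. x \<in> K \<Longrightarrow> cball x r \<subseteq> S"
    using compact_closed_neighbourhood[OF K(1) \<Omega> K(2)] by blast
  note [measurable] = g(1)
  have Sb [measurable]: "S \<in> sets borel" using S(1) by (simp add: compact_imp_closed)
  define U where "U x = indicator S x *\<^sub>R u x" for x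
  define G where "G x = indicator S x *\<^sub>R g x" for x
  have U: "integrable lborel U"
    unfolding U_def using borel_integrable_compact[OF S(1) continuous_on_subset[OF u S(2)]] .
  then have [measurable]: "U \<in> borel_measurable borel" by auto
  have G_meas [measurable]: "G \<in> borel_measurable borel"
    unfolding G_def by measurable
  have intpow: "integrable lborel (\<lambda>x. norm (G x) powr s)" if "Lp_loc s \<Omega> g" "s > 0" for s
  proof -
    have "integrable lebesgue (\<lambda>x. indicator S x *\<^sub>R norm (g x) powr s)"
      using that S by (auto simp: Lp_loc_def set_integrable_def)
    moreover have "(\<lambda>x. indicator S x *\<^sub>R norm (g x) powr s) = (\<lambda>x. norm (G x) powr s)"
      using that(2) by (auto simp: G_def indicator_def)
    ultimately show ?thesis by (simp add: integrable_completion)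
  qed
  have G: "integrable lborel G"
  proof -
    have "integrable lborel (\<lambda>x. norm (G x))"
      using intpow[of 1] g(2) by (simp add: has_weak_gradient_def)
    then show ?thesis by (simp add: integrable_norm_iff)
  qed
  have G_fin: "(\<integral>\<^sup>+x. norm (G x) powr p \<partial>lborel) < \<infinity>"
    using intpow[OF g(3)] p by (simp add: integrable_iff_bounded)
  define e where "e n = r * inverse (real (Suc n))" for n
  have e: "e n > 0" "e n \<le> r" for n
    using r by (auto simp: e_def field_simps mult_le_cancel_left1)
  have "e \<longlonglongrightarrow> r * 0"
    unfolding e_def by (intro tendsto_intros LIMSEQ_inverse_real_of_nat)
  then have e_lim: "filterlim e (at_right 0) sequentially"
    using e(1) by (auto simp: filterlim_at intro!: always_eventually) (metis less_irrefl)
  show thesis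
  proof (rule that[of "\<lambda>n. mollify (e n) U" "\<lambda>n. mollify (e n) G"])
    fix n x assume x: "x \<in> K"
    have cb: "cball x (e n) \<subseteq> S"
      using sub[OF x] e(2)[of n] by (meson order_trans subset_cball)
    have zero: "bump (e n) (y - x) = 0 \<and> bump_grad (e n) (y - x) = 0" if "y \<notin> S" for y
    proof -
      have "y \<notin> cball x (e n)" using cb that by blast
      then have "e n \<le> norm (y - x)" by (simp add: dist_norm norm_minus_commute)
      then show ?thesis by (simp add: bump_eq_0[OF e(1)] bump_grad_eq_0[OF e(1)])
    qed
    have "test_function \<Omega> (\<lambda>y. bump (e n) (y - x)) (\<lambda>y. bump_grad (e n) (y - x))"
      using cb S(2) by (intro test_function_bump e(1)) auto
    then have "(LINT y:\<Omega>|lebesgue. u y *\<^sub>R bump_grad (e n) (y - x)) = - (LINT y:\<Omega>|lebesgue. bump (e n) (y - x) *\<^sub>R g y)"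
      using g(2) unfolding has_weak_gradient_def by blast
    moreover have "(\<lambda>y. indicator \<Omega> y *\<^sub>R (u y *\<^sub>R bump_grad (e n) (y - x))) = (\<lambda>y. U y *\<^sub>R bump_grad (e n) (y - x))"
      "(\<lambda>y. indicator \<Omega> y *\<^sub>R (bump (e n) (y - x) *\<^sub>R g y)) = (\<lambda>y. bump (e n) (y - x) *\<^sub>R G y)"
      using zero S(2) by (auto simp: fun_eq_iff U_def G_def indicator_def)
    ultimately have "(LINT y|lborel. U y *\<^sub>R bump_grad (e n) (y - x)) = - (LINT y|lborel. bump (e n) (y - x) *\<^sub>R G y)"
      unfolding set_lebesgue_integral_def by (simp add: integral_completion)
    moreover have "bump_grad (e n) (x - y) = - bump_grad (e n) (y - x)" for y
      by (metis bump_grad_minus minus_diff_eq)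
    ultimately have "(LINT y|lborel. U y *\<^sub>R bump_grad (e n) (x - y)) = mollify (e n) G x"
      by (simp add: mollify_def bump_diff_commute[of "e n" x])
    with GDERIV_mollify[OF e(1) U, of n x] show "GDERIV (mollify (e n) U) x :> mollify (e n) G x"
      by simp
  next
    show "continuous_on UNIV (mollify (e n) U)" for n
      by (rule continuous_on_mollify[OF e(1) U])
    show "continuous_on UNIV (mollify (e n) G)" for n
      by (rule continuous_on_mollify[OF e(1) G])
    have cU: "continuous_on S U"
      using continuous_on_subset[OF u S(2)] by (rule continuous_on_eq) (simp add: U_def)
    have KS0: "x \<in> S" if "x \<in> K" for x
    proof -
      have "x \<in> cball x r" using r by simp
      then show ?thesis using sub[OF that] by blast
    qed
    have KS: "U x = u x" if "x \<in> K" for x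
      using KS0[OF that] by (simp add: U_def)
    show "uniform_limit K (\<lambda>n. mollify (e n) U) u sequentially"
    proof (rule uniform_limitI)
      fix t :: real assume t: "t > 0"
      have "\<forall>\<^sub>F d in at_right 0. \<forall>x\<in>K. norm (mollify d U x - U x) \<le> t / 2"
        using t by (intro mollify_uniform[OF U S(1) cU r sub]) auto
      from eventually_compose_filterlim[OF this e_lim]
      show "\<forall>\<^sub>F n in sequentially. \<forall>x\<in>K. dist (mollify (e n) U x) (u x) < t"
        by eventually_elim (use t KS in \<open>force simp: dist_norm\<close>)
    qed
    have KG: "G x = g x" if "x \<in> K" for x
      using KS0[OF that] by (simp add: G_def)
    show "(\<lambda>n. \<integral>\<^sup>+x\<in>K. norm (mollify (e n) G x - g x) powr p \<partial>lborel) \<longlonglongrightarrow> 0"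
    proof (rule tendsto_zero_ennreal)
      fix t :: real assume t: "t > 0"
      have "\<forall>\<^sub>F d in at_right 0. (\<integral>\<^sup>+x\<in>K. norm (mollify d G x - G x) powr p \<partial>lborel) \<le> t / 2"
        using t by (intro mollify_Lp[OF p G G_fin K(1)]) auto
      from eventually_compose_filterlim[OF this e_lim]
      show "\<forall>\<^sub>F n in sequentially. (\<integral>\<^sup>+x\<in>K. norm (mollify (e n) G x - g x) powr p \<partial>lborel) < ennreal t"
      proof eventually_elim
        case (elim n)
        have "(\<integral>\<^sup>+x\<in>K. norm (mollify (e n) G x - g x) powr p \<partial>lborel) = (\<integral>\<^sup>+x\<in>K. norm (mollify (e n) G x - G x) powr p \<partial>lborel)"
          using KG by (intro nn_integral_cong) (auto simp: indicator_def)
        also have "\<dots> \<le> ennreal (t / 2)" by (rule elim)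
        also have "\<dots> < ennreal t" using t by (intro ennreal_lessI) auto
        finally show ?case .
      qed
    qed
  qed
qed

section \<open>The field of the r-Laplacian and its radial subsolutions\<close>

lemma plap_field_measurable [measurable]: "plap_field r \<in> borel_measurable borel"
  unfolding plap_field_def[abs_def] by measurable

lemma norm_plap_field: "norm (plap_field r \<xi>) = norm \<xi> powr (r - 1)"
  by (cases "\<xi> = 0") (auto simp: plap_field_def powr_diff power2_eq_square field_simps)

text \<open>
  If the norms agree, both fields are the same multiple of the vectors.  Otherwise
  Cauchy-Schwarz bounds the product below by \<open>(s\<^sup>r\<^sup>-\<^sup>1 - t\<^sup>r\<^sup>-\<^sup>1) (s - t)\<close>, where \<open>s\<close> and \<open>t\<close> are the norms.
\<close>

lemma plap_field_strict_mono:
  assumes r: "r > 1" and neq: "a \<noteq> b"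
  shows "(plap_field r a - plap_field r b) \<bullet> (a - b) > 0"
proof (cases "norm a = norm b")
  case True
  have "plap_field r a - plap_field r b = norm a powr (r - 2) *\<^sub>R (a - b)"
    by (simp add: plap_field_def True scaleR_diff_right)
  moreover have "norm a powr (r - 2) > 0"
    using True neq by (cases "a = 0") auto
  ultimately show ?thesis
    using neq by simp
next
  case False
  define s t where "s = norm a" and "t = norm b"
  have pow: "c powr (r - 2) * c = c powr (r - 1)" if "c \<ge> 0" for c :: real
    using that by (cases "c = 0") (auto simp: powr_diff power2_eq_square)
  have nonneg: "s \<ge> 0" "t \<ge> 0" by (auto simp: s_def t_def)
  have cs: "a \<bullet> b \<le> s * t"
    unfolding s_def t_def by (rule norm_cauchy_schwarz)
  have "s powr (r - 2) * (a \<bullet> b) \<le> s powr (r - 2) * (s * t)" "t powr (r - 2) * (a \<bullet> b) \<le> t powr (r - 2) * (s * t)"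
    using cs by (auto intro: mult_left_mono)
  moreover have "s powr (r - 2) * (s * t) = s powr (r - 1) * t" "t powr (r - 2) * (s * t) = t powr (r - 1) * s"
    using pow[of s] pow[of t] nonneg by (metis mult.assoc, metis mult.assoc mult.commute)
  moreover have "s powr (r - 2) * (s * s) = s powr (r - 1) * s" "t powr (r - 2) * (t * t) = t powr (r - 1) * t"
    using pow[of s] pow[of t] nonneg by (metis mult.assoc)+
  moreover have "(plap_field r a - plap_field r b) \<bullet> (a - b)
      = s powr (r - 2) * (s * s) + t powr (r - 2) * (t * t) - s powr (r - 2) * (a \<bullet> b) - t powr (r - 2) * (a \<bullet> b)"
    by (simp add: plap_field_def s_def t_def inner_diff_left inner_diff_right inner_commute[of b a]
        dot_square_norm power2_eq_square algebra_simps)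
  moreover have "(s powr (r - 1) - t powr (r - 1)) * (s - t)
      = s powr (r - 1) * s - s powr (r - 1) * t - t powr (r - 1) * s + t powr (r - 1) * t"
    by (simp add: algebra_simps)
  ultimately have "(plap_field r a - plap_field r b) \<bullet> (a - b) \<ge> (s powr (r - 1) - t powr (r - 1)) * (s - t)"
    by linarith
  moreover have "(s powr (r - 1) - t powr (r - 1)) * (s - t) > 0"
  proof (cases "s < t")
    case True
    then have "s powr (r - 1) < t powr (r - 1)"
      using r nonneg by (intro powr_less_mono2) auto
    with True show ?thesis by (intro mult_neg_neg) auto
  next
    case False
    then have "t < s" using \<open>norm a \<noteq> norm b\<close> by (simp add: s_def t_def)
    then have "t powr (r - 1) < s powr (r - 1)"
      using r nonneg by (intro powr_less_mono2) auto
    with \<open>t < s\<close> show ?thesis by (intro mult_pos_pos) auto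
  qed
  ultimately show ?thesis by linarith
qed

lemma plap_field_mono: "r > 1 \<Longrightarrow> (plap_field r a - plap_field r b) \<bullet> (a - b) \<ge> 0"
  using plap_field_strict_mono[of r a b] by (cases "a = b") auto

lemma continuous_on_glue_0:
  fixes f :: "'a::topological_space \<Rightarrow> 'b::{topological_space, zero}"
  assumes "open D" "closed S" "S \<subseteq> D" "continuous_on D f" "\<And>x. x \<notin> S \<Longrightarrow> f x = 0"
  shows "continuous_on UNIV f"
proof -
  have "continuous_on (- S) f"
    by (rule continuous_on_eq[OF continuous_on_const]) (simp add: assms(5))
  then have "continuous_on (D \<union> - S) f"
    using assms by (intro continuous_on_open_Un) auto
  moreover have "D \<union> - S = UNIV" using assms(3) by auto
  ultimately show ?thesis by simp
qed

lemma GDERIV_glue_0: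
  assumes "open D" "closed S" "S \<subseteq> D" "\<And>x. x \<in> D \<Longrightarrow> GDERIV f x :> g x"
    and "\<And>x. x \<notin> S \<Longrightarrow> f x = 0" "\<And>x. x \<notin> S \<Longrightarrow> g x = 0"
  shows "GDERIV f x :> g x"
proof (cases "x \<in> S")
  case False
  have "GDERIV f x :> 0"
    by (rule GDERIV_transform_open[OF GDERIV_const[where k = 0], of "- S"]) (use False assms in auto)
  then show ?thesis using assms(6)[OF False] by simp
qed (use assms in auto)

text \<open>
  The conditions off \<open>S\<close> are what a function given by a formula on \<open>D\<close> and extended by zero satisfies
  once the formula vanishes outside \<open>S\<close>.
\<close>

lemma test_function_glue:
  assumes D: "open D" and S: "compact S" "S \<subseteq> D"
    and d: "\<And>x. x \<in> D \<Longrightarrow> GDERIV f x :> g x" and c: "continuous_on D g"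
    and z: "\<And>x. x \<notin> S \<Longrightarrow> f x = 0" "\<And>x. x \<notin> S \<Longrightarrow> g x = 0"
  shows "test_function D f g"
  unfolding test_function_def
proof (intro conjI allI)
  have Sc: "closed S" using S(1) by (rule compact_imp_closed)
  show "GDERIV f x :> g x" for x
    using GDERIV_glue_0[OF D Sc S(2) d z] .
  show "continuous_on UNIV g"
    using continuous_on_glue_0[OF D Sc S(2) c z(2)] .
  have cl: "closure {x. f x \<noteq> 0} \<subseteq> S"
    using z(1) by (intro closure_minimal Sc) auto
  then show "closure {x. f x \<noteq> 0} \<subseteq> D"
    using S(2) by blast
  show "compact (closure {x. f x \<noteq> 0})"
    using compact_Int_closed[OF S(1) closed_closure, of "{x. f x \<noteq> 0}"] cl
    by (simp add: Int_absorb1)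
qed

lemma GDERIV_norm_powr:
  fixes x :: "'a::euclidean_space"
  assumes "x \<noteq> 0"
  shows "GDERIV (\<lambda>x. norm x powr a) x :> (a * norm x powr (a - 2)) *\<^sub>R x"
proof -
  have "GDERIV (\<lambda>x. norm x powr a) x :> (a * norm x powr (a - 1)) *\<^sub>R sgn x"
    using assms by (intro GDERIV_DERIV_compose[OF GDERIV_norm] has_real_derivative_powr) auto
  moreover have "(a * norm x powr (a - 1)) *\<^sub>R sgn x = (a * norm x powr (a - 2)) *\<^sub>R x"
    using assms by (simp add: sgn_div_norm powr_diff power2_eq_square field_simps)
  ultimately show ?thesis by simp
qed

text \<open>
  Apply \<open>integral_gradient_inner_position\<close> to \<open>F x = |x|\<^sup>-\<^sup>s \<phi> x\<close>.  This is a test function because \<open>\<phi>\<close>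
  vanishes near the origin.
\<close>

lemma integral_radial_power_gradient:
  fixes \<phi> :: "'a::euclidean_space \<Rightarrow> real"
  assumes tf: "test_function (- {0}) \<phi> \<psi>"
  shows "(LINT x|lborel. norm x powr (- s) * (x \<bullet> \<psi> x)) = (s - real DIM('a)) * (LINT x|lborel. norm x powr (- s) * \<phi> x)"
proof -
  define S where "S = closure {x. \<phi> x \<noteq> 0}"
  have S: "compact S" "S \<subseteq> - {0}" and d: "\<And>x. GDERIV \<phi> x :> \<psi> x" and c: "continuous_on UNIV \<psi>"
    using tf by (auto simp: test_function_def S_def)
  have z: "\<phi> x = 0" "\<psi> x = 0" if "x \<notin> S" for x
    using test_function_eq_0[OF tf that[unfolded S_def]] .
  have c0: "continuous_on UNIV \<phi>" using d by (rule GDERIV_imp_continuous_on)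
  define F where "F x = norm x powr (- s) * \<phi> x" for x
  define G where "G x = norm x powr (- s) *\<^sub>R \<psi> x + \<phi> x *\<^sub>R ((- s * norm x powr (- s - 2)) *\<^sub>R x)" for x
  have cpow: "continuous_on (- {0}) (\<lambda>x::'a. norm x powr a)" for a
    by (intro continuous_intros) auto
  have tfF: "test_function (- {0}) F G"
  proof (rule test_function_glue[OF _ S])
    show "GDERIV F x :> G x" if "x \<in> - {0}" for x
      unfolding F_def G_def using that by (intro GDERIV_mult GDERIV_norm_powr d) auto
    show "continuous_on (- {0}) G"
      unfolding G_def by (intro continuous_intros continuous_on_subset[OF c] continuous_on_subset[OF c0] cpow) auto
  qed (auto simp: F_def G_def z)
  have F_int: "integrable lborel F"
  proof (rule integrable_continuous_compact_support[OF _ S(1)])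
    show "continuous_on UNIV F"
      using tfF by (intro GDERIV_imp_continuous_on) (auto simp: test_function_def)
  qed (simp add: F_def z)
  have P_int: "integrable lborel (\<lambda>x. norm x powr (- s) * (x \<bullet> \<psi> x))"
  proof (rule integrable_continuous_compact_support[OF _ S(1)])
    show "continuous_on UNIV (\<lambda>x. norm x powr (- s) * (x \<bullet> \<psi> x))"
      by (rule continuous_on_glue_0[OF _ compact_imp_closed[OF S(1)] S(2)])
         (auto simp: z intro!: continuous_intros continuous_on_subset[OF c] cpow)
  qed (simp add: z)
  have "G x \<bullet> x = norm x powr (- s) * (x \<bullet> \<psi> x) - s * F x" for x
  proof (cases "x = 0")
    case False
    then have "norm x powr (- s - 2) * (norm x * norm x) = norm x powr (- s)"
      by (simp add: powr_diff power2_eq_square)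
    then have eq: "norm x powr (- s - 2) * (x \<bullet> x) = norm x powr (- s)"
      by (simp add: dot_square_norm power2_eq_square)
    have "G x \<bullet> x = norm x powr (- s) * (\<psi> x \<bullet> x) + \<phi> x * (- s * (norm x powr (- s - 2) * (x \<bullet> x)))"
      by (simp only: G_def inner_add_left inner_scaleR_left mult.assoc)
    then show ?thesis
      unfolding eq F_def by (simp add: inner_commute)
  qed (use z[of 0] S(2) in \<open>auto simp: G_def F_def\<close>)
  then have "(LINT x|lborel. G x \<bullet> x) = (LINT x|lborel. norm x powr (- s) * (x \<bullet> \<psi> x)) - s * (LINT x|lborel. F x)"
    using F_int P_int by simp
  with integral_gradient_inner_position[OF tfF] show ?thesis
    by (simp add: F_def algebra_simps)
qed

text \<open>
  The argument of the field is the gradient of \<open>\<kappa> |x|\<^sup>-\<^sup>\<theta>\<close> for \<open>c = \<kappa> \<theta>\<close>.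
\<close>

lemma plap_field_radial:
  fixes x :: "'a::euclidean_space"
  assumes "x \<noteq> 0" "c > 0"
  shows "plap_field r (- (c * norm x powr (- \<theta> - 2)) *\<^sub>R x)
    = - (c powr (r - 1) * norm x powr (- ((\<theta> + 1) * (r - 1) + 1))) *\<^sub>R x"
proof -
  have n: "norm (- (c * norm x powr (- \<theta> - 2)) *\<^sub>R x) = c * norm x powr (- \<theta> - 1)"
    using assms by (simp add: abs_mult powr_diff power2_eq_square field_simps)
  have "(c * norm x powr (- \<theta> - 1)) powr (r - 2) * (c * norm x powr (- \<theta> - 2))
     = (c powr (r - 2) * c powr 1) * (norm x powr ((- \<theta> - 1) * (r - 2)) * norm x powr (- \<theta> - 2))"
    using assms by (simp add: powr_mult powr_powr)
  also have "\<dots> = c powr (r - 1) * norm x powr (- ((\<theta> + 1) * (r - 1) + 1))"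
    unfolding powr_add[symmetric] by (simp add: algebra_simps)
  finally show ?thesis
    unfolding plap_field_def n by simp
qed

text \<open>
  The field is \<open>- c\<^sup>r\<^sup>-\<^sup>1 |x|\<^sup>-\<^sup>s x\<close> with \<open>s = (\<theta> + 1) (r - 1) + 1\<close>, and the sign is decided by \<open>s - N\<close>.  The
  condition on \<open>\<theta>\<close> says precisely \<open>s \<ge> N\<close>.
\<close>

lemma power_subsolution:
  fixes \<phi> :: "'a::euclidean_space \<Rightarrow> real"
  assumes tf: "test_function (- {0}) \<phi> \<psi>" and nonneg: "\<And>x. \<phi> x \<ge> 0"
    and c: "c > 0" and \<theta>: "\<theta> * (r - 1) \<ge> real DIM('a) - r"
  shows "(LINT x|lborel. plap_field r (- (c * norm x powr (- \<theta> - 2)) *\<^sub>R x) \<bullet> \<psi> x) \<le> 0"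
proof -
  define s where "s = (\<theta> + 1) * (r - 1) + 1"
  have "\<psi> 0 = 0"
    using tf by (intro test_function_eq_0[OF tf]) (auto simp: test_function_def)
  then have "plap_field r (- (c * norm x powr (- \<theta> - 2)) *\<^sub>R x) \<bullet> \<psi> x = - (c powr (r - 1)) * (norm x powr (- s) * (x \<bullet> \<psi> x))" for x
    using plap_field_radial[OF _ c, of x r \<theta>] by (cases "x = 0") (auto simp: s_def)
  then have "(LINT x|lborel. plap_field r (- (c * norm x powr (- \<theta> - 2)) *\<^sub>R x) \<bullet> \<psi> x)
     = - (c powr (r - 1)) * ((s - real DIM('a)) * (LINT x|lborel. norm x powr (- s) * \<phi> x))"
    by (simp add: integral_radial_power_gradient[OF tf])
  also have "\<dots> \<le> 0"
  proof -
    have "s - real DIM('a) \<ge> 0"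
      using \<theta> by (simp add: s_def algebra_simps)
    moreover have "(LINT x|lborel. norm x powr (- s) * \<phi> x) \<ge> 0"
      using nonneg by (intro Bochner_Integration.integral_nonneg) auto
    ultimately have "c powr (r - 1) * ((s - real DIM('a)) * (LINT x|lborel. norm x powr (- s) * \<phi> x)) \<ge> 0"
      by (intro mult_nonneg_nonneg) auto
    then show ?thesis by simp
  qed
  finally show ?thesis .
qed

section \<open>Passing to the limit in the tested inequality\<close>

text \<open>
  Young's inequality with a small weight, proved by comparing \<open>b\<close> with \<open>t a\<close>.  With
  \<open>a = 1 + |g|\<close> and \<open>b = |h n - g|\<close> it turns \<open>L\<^sup>p\<close> convergence into
  convergence of the pairing with a field of growth \<open>p - 1\<close>.
\<close>

lemma young_weight_le:
  fixes a b t p :: real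
  assumes "a \<ge> 0" "b \<ge> 0" "t > 0" "p \<ge> 1"
  shows "a powr (p - 1) * b \<le> t * a powr p + t powr (1 - p) * b powr p"
proof (cases "b \<le> t * a")
  case True
  have pow: "a powr (p - 1) * a = a powr p"
    using assms by (cases "a = 0") (auto simp: powr_diff)
  have "a powr (p - 1) * b \<le> a powr (p - 1) * (t * a)"
    using True by (intro mult_left_mono) auto
  also have "\<dots> = t * a powr p"
    by (simp add: pow[symmetric] mult_ac)
  finally show ?thesis
    by (simp add: add_increasing2)
next
  case False
  then have b: "b > 0" "a \<le> b / t"
    using assms by (auto simp: field_simps) (smt (verit) mult_nonneg_nonneg)
  have "a powr (p - 1) \<le> (b / t) powr (p - 1)"
    using b assms by (intro powr_mono2) auto
  then have "a powr (p - 1) * b \<le> (b / t) powr (p - 1) * b"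
    using b by (intro mult_right_mono) auto
  also have "\<dots> = t powr (1 - p) * b powr p"
    using b assms by (simp add: powr_divide powr_diff)
  finally show ?thesis
    using assms by (simp add: add_increasing)
qed

text \<open>
  The convergence makes \<open>s n - f\<close>, hence \<open>s n\<close>, integrable from some index on, and finitely many
  terms do not affect the limit.
\<close>

lemma integral_tendsto_L1:
  fixes f :: "'a \<Rightarrow> real"
  assumes f: "integrable M f" and s: "\<And>n. s n \<in> borel_measurable M"
    and lim: "(\<lambda>n. \<integral>\<^sup>+x. \<bar>s n x - f x\<bar> \<partial>M) \<longlonglongrightarrow> 0"
  shows "(\<lambda>n. LINT x|M. s n x) \<longlonglongrightarrow> (LINT x|M. f x)"
proof -
  note [measurable] = borel_measurable_integrable[OF f] s
  obtain N where N: "\<And>n. n \<ge> N \<Longrightarrow> (\<integral>\<^sup>+x. \<bar>s n x - f x\<bar> \<partial>M) < 1"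
    using order_tendstoD(2)[OF lim, of 1] by (auto simp: eventually_sequentially)
  have int: "integrable M (s (n + N))" for n
  proof -
    have "integrable M (\<lambda>x. s (n + N) x - f x)"
      using N[of "n + N"] by (intro integrableI_bounded) (auto simp: less_top[symmetric] dest: less_trans[of _ 1 top])
    from Bochner_Integration.integrable_add[OF this f] show ?thesis by simp
  qed
  have "(\<lambda>n. LINT x|M. s (n + N) x) \<longlonglongrightarrow> (LINT x|M. f x)"
    by (rule tendsto_L1_int[OF int f]) (use LIMSEQ_ignore_initial_segment[OF lim, of N] in simp)
  then show ?thesis by (rule LIMSEQ_offset)
qed

text \<open>
  Here \<open>W - h n\<close> stands for the gradients of the test functions without the factor \<open>\<mu> n\<close>
  produced by the chain rule.  The factors converge uniformly; the error coming from
  \<open>h n - g\<close> is split by \<open>young_weight_le\<close> with a small parameter \<open>t\<close>, chosen before \<open>n\<close>.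
\<close>

lemma
  fixes g B W :: "'a::euclidean_space \<Rightarrow> 'a" and m :: "'a \<Rightarrow> real"
  assumes K: "compact K" and p: "p > 1"
    and meas: "g \<in> borel_measurable borel" "B \<in> borel_measurable borel" "W \<in> borel_measurable borel"
      "m \<in> borel_measurable borel"
    and g: "(\<integral>\<^sup>+x\<in>K. norm (g x) powr p \<partial>lborel) < \<infinity>"
    and B: "C \<ge> 0" "\<And>x. x \<in> K \<Longrightarrow> norm (B x) \<le> C * (1 + norm (g x)) powr (p - 1)"
    and W: "\<And>x. x \<in> K \<Longrightarrow> norm (W x) \<le> D" and m: "\<And>x. x \<in> K \<Longrightarrow> \<bar>m x\<bar> \<le> E"
    and ne: "D \<ge> 0" "E \<ge> 0"
  shows integrable_weighted_flux: "integrable lborel (\<lambda>x. indicator K x * (m x * (B x \<bullet> (W x - g x))))"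
    and weighted_flux_tendsto: "\<And>\<mu> h. \<lbrakk>\<And>n. \<mu> n \<in> borel_measurable borel; \<And>n. h n \<in> borel_measurable borel;
        uniform_limit K \<mu> m sequentially;
        (\<lambda>n. \<integral>\<^sup>+x\<in>K. norm (h n x - g x) powr p \<partial>lborel) \<longlonglongrightarrow> 0\<rbrakk> \<Longrightarrow>
      (\<lambda>n. LINT x|lborel. indicator K x * (\<mu> n x * (B x \<bullet> (W x - h n x))))
        \<longlonglongrightarrow> (LINT x|lborel. indicator K x * (m x * (B x \<bullet> (W x - g x))))"
proof -
  have [measurable]: "K \<in> sets borel" using K by (simp add: compact_imp_closed)
  note [measurable] = meas
  define a where "a x = 1 + norm (g x)" for x
  have [measurable]: "a \<in> borel_measurable borel" unfolding a_def by measurable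
  have a1: "a x \<ge> 1" for x by (simp add: a_def)
  have pow: "a x powr (p - 1) * a x = a x powr p" for x
    using a1[of x] by (simp add: powr_diff)
  define I where "I = (\<integral>\<^sup>+x. ennreal (a x powr p) * indicator K x \<partial>lborel)"
  have "I \<le> (\<integral>\<^sup>+x. ennreal (2 powr p) * (ennreal (norm (g x) powr p) * indicator K x + indicator K x) \<partial>lborel)"
    unfolding I_def
  proof (intro nn_integral_mono)
    fix x
    have "a x powr p \<le> 2 powr p * (1 powr p + norm (g x) powr p)"
      unfolding a_def using p by (intro powr_add_le) auto
    then have "ennreal (a x powr p) \<le> ennreal (2 powr p) * (ennreal (norm (g x) powr p) + 1)"
      by (simp add: ennreal_mult[symmetric] ennreal_plus[symmetric] ennreal_1[symmetric] add.commute del: ennreal_plus ennreal_1)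
    then show "ennreal (a x powr p) * indicator K x \<le> ennreal (2 powr p) * (ennreal (norm (g x) powr p) * indicator K x + indicator K x)"
      by (auto simp: indicator_def)
  qed
  also have "\<dots> = ennreal (2 powr p) * ((\<integral>\<^sup>+x\<in>K. norm (g x) powr p \<partial>lborel) + emeasure lborel K)"
    by (simp add: nn_integral_cmult nn_integral_add)
  also have "\<dots> < \<infinity>"
    using g emeasure_compact_finite[OF K] by (simp add: ennreal_mult_less_top)
  finally have I: "I < \<infinity>" .
  have Wg: "norm (W x - g x) \<le> (D + 1) * a x" if "x \<in> K" for x
  proof -
    have "norm (W x - g x) \<le> D + norm (g x)"
      using norm_triangle_ineq4[of "W x" "g x"] W[OF that] by linarith
    also have "\<dots> \<le> (D + 1) * a x"
      using ne by (simp add: a_def algebra_simps)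
    finally show ?thesis .
  qed
  have flux_le: "\<bar>c * (B x \<bullet> y)\<bar> \<le> c' * (C * (a x powr (p - 1) * y'))"
    if "x \<in> K" "\<bar>c\<bar> \<le> c'" "norm y \<le> y'" for c c' x y y'
  proof -
    have "\<bar>c\<bar> * \<bar>B x \<bullet> y\<bar> \<le> c' * (norm (B x) * norm y)"
      using that by (intro mult_mono Cauchy_Schwarz_ineq2) auto
    also have "\<dots> \<le> c' * (C * a x powr (p - 1) * y')"
      using that B by (intro mult_left_mono mult_mono) (auto simp: a_def)
    finally show ?thesis by (simp add: abs_mult mult.assoc)
  qed
  show int: "integrable lborel (\<lambda>x. indicator K x * (m x * (B x \<bullet> (W x - g x))))"
  proof (rule integrableI_bounded)
    have "(\<integral>\<^sup>+x. norm (indicator K x * (m x * (B x \<bullet> (W x - g x)))) \<partial>lborel)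
       \<le> (\<integral>\<^sup>+x. ennreal (E * C * (D + 1)) * (ennreal (a x powr p) * indicator K x) \<partial>lborel)"
    proof (intro nn_integral_mono)
      fix x
      show "ennreal (norm (indicator K x * (m x * (B x \<bullet> (W x - g x))))) \<le> ennreal (E * C * (D + 1)) * (ennreal (a x powr p) * indicator K x)"
      proof (cases "x \<in> K")
        case True
        have "\<bar>m x * (B x \<bullet> (W x - g x))\<bar> \<le> E * (C * (a x powr (p - 1) * ((D + 1) * a x)))"
          using True by (intro flux_le m Wg)
        also have "\<dots> = E * C * (D + 1) * a x powr p"
          by (simp add: pow[symmetric] mult_ac)
        finally show ?thesis
          using True ne B(1) by (simp add: ennreal_mult[symmetric])
      qed auto
    qed
    also have "\<dots> < \<infinity>"
      using I by (simp add: nn_integral_cmult I_def[symmetric] ennreal_mult_less_top)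
    finally show "(\<integral>\<^sup>+x. norm (indicator K x * (m x * (B x \<bullet> (W x - g x)))) \<partial>lborel) < \<infinity>" .
  qed measurable
  fix \<mu> h
  assume meas2: "\<And>n. \<mu> n \<in> borel_measurable borel" "\<And>n. h n \<in> borel_measurable borel"
    and \<mu>: "uniform_limit K \<mu> m sequentially"
    and h: "(\<lambda>n. \<integral>\<^sup>+x\<in>K. norm (h n x - g x) powr p \<partial>lborel) \<longlonglongrightarrow> 0"
  note [measurable] = meas2
  show "(\<lambda>n. LINT x|lborel. indicator K x * (\<mu> n x * (B x \<bullet> (W x - h n x))))
        \<longlonglongrightarrow> (LINT x|lborel. indicator K x * (m x * (B x \<bullet> (W x - g x))))"
  proof (rule integral_tendsto_L1[OF int])
    show "(\<lambda>n. \<integral>\<^sup>+x. \<bar>indicator K x * (\<mu> n x * (B x \<bullet> (W x - h n x))) - indicator K x * (m x * (B x \<bullet> (W x - g x)))\<bar> \<partial>lborel) \<longlonglongrightarrow> 0"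
    proof (rule tendsto_zero_ennreal)
      fix \<tau> :: real assume \<tau>: "\<tau> > 0"
      obtain J where J: "I = ennreal J" "J \<ge> 0"
        using I by (cases I) auto
      \<comment> \<open>The final estimate is \<open>t c1 \<integral>\<^sub>K (1 + |g|)\<^sup>p + c2 \<integral>\<^sub>K |h n - g|\<^sup>p\<close>; the choice of \<open>t\<close> makes the first term at most \<open>\<tau> / 2\<close>.\<close>
      define c1 where "c1 = C * (D + 2 + E)"
      define t where "t = min 1 (\<tau> / (2 * (c1 * J + 1)))"
      have c1: "c1 \<ge> 0" using B(1) ne by (simp add: c1_def)
      have t: "t > 0" "t \<le> 1" using \<tau> c1 J by (auto simp: t_def intro!: divide_pos_pos add_nonneg_pos)
      have tJ: "t * c1 * J \<le> \<tau> / 2"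
      proof -
        have "t * (c1 * J) \<le> \<tau> / (2 * (c1 * J + 1)) * (c1 * J + 1)"
          using c1 J \<tau> t by (intro mult_mono) (auto simp: t_def)
        also have "\<dots> = \<tau> / 2"
          using c1 J by (simp add: add_nonneg_eq_0_iff field_simps)
        finally show ?thesis by (simp add: mult.assoc)
      qed
      define c2 where "c2 = C * (1 + E) * t powr (1 - p)"
      have c2: "c2 \<ge> 0" using B(1) ne by (simp add: c2_def)
      have "\<forall>\<^sub>F n in sequentially. \<forall>x\<in>K. dist (\<mu> n x) (m x) < t"
        using \<mu> t(1) by (rule uniform_limitD)
      moreover have "\<forall>\<^sub>F n in sequentially. (\<integral>\<^sup>+x\<in>K. norm (h n x - g x) powr p \<partial>lborel) < ennreal (\<tau> / (2 * (c2 + 1)))"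
        using \<tau> c2 by (intro order_tendstoD(2)[OF h]) auto
      ultimately show "\<forall>\<^sub>F n in sequentially. (\<integral>\<^sup>+x. \<bar>indicator K x * (\<mu> n x * (B x \<bullet> (W x - h n x))) - indicator K x * (m x * (B x \<bullet> (W x - g x)))\<bar> \<partial>lborel) < ennreal \<tau>"
      proof eventually_elim
        case (elim n)
        have "(\<integral>\<^sup>+x. \<bar>indicator K x * (\<mu> n x * (B x \<bullet> (W x - h n x))) - indicator K x * (m x * (B x \<bullet> (W x - g x)))\<bar> \<partial>lborel)
          \<le> (\<integral>\<^sup>+x. ennreal (t * c1) * (ennreal (a x powr p) * indicator K x) + ennreal c2 * (ennreal (norm (h n x - g x) powr p) * indicator K x) \<partial>lborel)"
        proof (intro nn_integral_mono)
          fix x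
          show "ennreal \<bar>indicator K x * (\<mu> n x * (B x \<bullet> (W x - h n x))) - indicator K x * (m x * (B x \<bullet> (W x - g x)))\<bar>
            \<le> ennreal (t * c1) * (ennreal (a x powr p) * indicator K x) + ennreal c2 * (ennreal (norm (h n x - g x) powr p) * indicator K x)"
          proof (cases "x \<in> K")
            case True
            define b where "b = norm (h n x - g x)"
            define w where "w = a x powr (p - 1)"
            have md: "\<bar>\<mu> n x - m x\<bar> \<le> t" using elim(1) True by (force simp: dist_real_def)
            have mu: "\<bar>\<mu> n x\<bar> \<le> 1 + E" using md m[OF True] t(2) by linarith
            have "\<mu> n x * (B x \<bullet> (W x - h n x)) - m x * (B x \<bullet> (W x - g x))
                = (\<mu> n x - m x) * (B x \<bullet> (W x - g x)) + \<mu> n x * (B x \<bullet> (g x - h n x))"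
              by (simp add: inner_diff_right algebra_simps)
            also have "\<bar>\<dots>\<bar> \<le> t * (C * (w * ((D + 1) * a x))) + (1 + E) * (C * (w * b))"
              unfolding w_def using True md mu
              by (intro order_trans[OF abs_triangle_ineq] add_mono flux_le Wg) (auto simp: b_def norm_minus_commute)
            also have "\<dots> \<le> t * (C * (w * ((D + 1) * a x))) + (1 + E) * (C * (t * a x powr p + t powr (1 - p) * b powr p))"
              unfolding w_def using a1[of x] t p ne B(1)
              by (intro add_left_mono mult_left_mono young_weight_le) (auto simp: b_def)
            also have "t * (C * (w * ((D + 1) * a x))) = t * C * (D + 1) * a x powr p"
              by (simp add: pow[symmetric] w_def mult_ac)
            also have "t * C * (D + 1) * a x powr p + (1 + E) * (C * (t * a x powr p + t powr (1 - p) * b powr p))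
                = t * c1 * a x powr p + c2 * b powr p"
              by (simp add: c1_def c2_def algebra_simps)
            finally show ?thesis
              using True c1 c2 t by (simp add: b_def ennreal_mult[symmetric] ennreal_plus[symmetric] ennreal_leI del: ennreal_plus)
          qed auto
        qed
        also have "\<dots> = ennreal (t * c1) * I + ennreal c2 * (\<integral>\<^sup>+x\<in>K. norm (h n x - g x) powr p \<partial>lborel)"
          by (simp add: nn_integral_add nn_integral_cmult I_def)
        also have "\<dots> \<le> ennreal (t * c1) * ennreal J + ennreal c2 * ennreal (\<tau> / (2 * (c2 + 1)))"
          using elim(2) J by (intro add_mono mult_left_mono) auto
        also have "\<dots> = ennreal (t * c1 * J + c2 * (\<tau> / (2 * (c2 + 1))))"
          using c1 c2 t J \<tau> by (simp add: ennreal_mult[symmetric] ennreal_plus[symmetric] del: ennreal_plus)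
        also have "\<dots> < ennreal \<tau>"
        proof (rule ennreal_lessI[OF \<tau>])
          have "c2 * (\<tau> / (2 * (c2 + 1))) < \<tau> / 2"
            using c2 \<tau> by (simp add: field_simps)
          with tJ show "t * c1 * J + c2 * (\<tau> / (2 * (c2 + 1))) < \<tau>" by linarith
        qed
        finally show ?case .
      qed
    qed
  qed measurable
qed

section \<open>Comparison principle\<close>

lemma test_function_mono: "test_function D \<phi> \<psi> \<Longrightarrow> D \<subseteq> \<Omega> \<Longrightarrow> test_function \<Omega> \<phi> \<psi>"
  by (auto simp: test_function_def)

text \<open>
  Suppose \<open>w - u\<close> exceeds \<open>t\<close> at \<open>x0\<close>, and let \<open>T\<close> lie halfway between.  The functions
  \<open>\<Phi> n = (max 0 (w - v n - T))\<^sup>2\<close> with smooth \<open>v n\<close> near \<open>u\<close> are test functions for large \<open>n\<close>: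
  on \<open>K\<close> their support lies in the compact set \<open>{w - u \<ge> t}\<close>, which the boundary condition keeps inside \<open>D\<close>.  Testing the
  two inequalities and letting \<open>n\<close> grow gives \<open>W = g\<close> almost everywhere on \<open>{w - u > T}\<close>.  Then
  the integrals of \<open>\<Phi> n\<close> tend to zero, although \<open>\<Phi> n\<close> is bounded below on a ball around \<open>x0\<close>.
\<close>

lemma weak_comparison:
  fixes u w :: "'a::euclidean_space \<Rightarrow> real" and g W :: "'a \<Rightarrow> 'a"
  assumes q: "1 < q" "q \<le> p" and \<Omega>: "open \<Omega>" and u: "continuous_on \<Omega> u"
    and g: "g \<in> borel_measurable borel" "has_weak_gradient \<Omega> u g" "Lp_loc p \<Omega> g"
    and super: "\<And>\<phi> \<psi>. test_function \<Omega> \<phi> \<psi> \<Longrightarrow> (\<And>x. \<phi> x \<ge> 0) \<Longrightarrow>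
      (LINT x:\<Omega>|lebesgue. plap_field p (g x) \<bullet> \<psi> x) + (LINT x:\<Omega>|lebesgue. plap_field q (g x) \<bullet> \<psi> x) \<ge> 0"
    and K: "compact K" "K \<subseteq> \<Omega>" and D: "open D" "D \<subseteq> K"
    and w: "\<And>x. x \<in> K \<Longrightarrow> GDERIV w x :> W x" "continuous_on K W"
    and sub: "\<And>\<phi> \<psi>. test_function D \<phi> \<psi> \<Longrightarrow> (\<And>x. \<phi> x \<ge> 0) \<Longrightarrow>
      (LINT x|lborel. plap_field p (W x) \<bullet> \<psi> x) + (LINT x|lborel. plap_field q (W x) \<bullet> \<psi> x) \<le> 0"
    and boundary: "\<And>x. x \<in> K - D \<Longrightarrow> w x - u x < t" and x0: "x0 \<in> D"
  shows "w x0 - u x0 \<le> t"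
proof (rule ccontr)
  assume contra: "\<not> w x0 - u x0 \<le> t"
  define \<delta> where "\<delta> = (w x0 - u x0 - t) / 2"
  define T where "T = t + \<delta>"
  have \<delta>: "\<delta> > 0" "w x0 - u x0 = T + \<delta>"
    using contra by (auto simp: \<delta>_def T_def field_simps)
  have p: "p > 1" using q by simp
  have wK: "continuous_on K w" by (rule GDERIV_imp_continuous_on) (rule w)
  have uK: "continuous_on K u" by (rule continuous_on_subset[OF u K(2)])
  have Kc: "closed K" using K(1) by (rule compact_imp_closed)
  have Kb [measurable]: "K \<in> sets borel" using Kc by simp
  have Db [measurable]: "D \<in> sets borel" using D by simp
  note [measurable] = g(1)
  define S where "S = K \<inter> (\<lambda>x. w x - u x) -` {t..}"
  have "closed S"
    unfolding S_def by (intro continuous_closed_preimage continuous_intros wK uK Kc)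
  then have S: "compact S"
    using compact_Int_closed[OF K(1), of S] by (simp add: S_def Int_absorb1 Int_assoc[symmetric])
  have SD: "S \<subseteq> D" using boundary by (force simp: S_def)
  obtain v h where vh: "\<And>n x. x \<in> K \<Longrightarrow> GDERIV (v n) x :> h n x" "\<And>n. continuous_on UNIV (v n)"
    "\<And>n. continuous_on UNIV (h n)" and v: "uniform_limit K v u sequentially"
    and h: "(\<lambda>n. \<integral>\<^sup>+x\<in>K. norm (h n x - g x) powr p \<partial>lborel) \<longlonglongrightarrow> 0"
    by (rule local_smooth_approximation[OF p \<Omega> u g K]) (rule that, auto)
  have h_meas [measurable]: "h n \<in> borel_measurable borel" for n
    using vh(3) by (rule borel_measurable_continuous_onI)
  \<comment> \<open>The extension by zero is Borel measurable on the whole space, like all integrands below.\<close>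
  define W' where "W' x = (if x \<in> K then W x else 0)" for x
  have [measurable]: "W' \<in> borel_measurable borel"
    unfolding W'_def by (intro borel_measurable_continuous_on_if w(2) Kb continuous_on_const)
  \<comment> \<open>The derivative of \<open>s \<mapsto> (max 0 (s - T))\<^sup>2\<close> at \<open>s = w x - f x\<close>.\<close>
  define k where "k f x = (if x \<in> D then 2 * max 0 (w x - f x - T) else 0)" for f :: "'a \<Rightarrow> real" and x
  have k_meas: "k f \<in> borel_measurable borel" if "continuous_on K f" for f
    unfolding k_def using D(2) that wK
    by (intro borel_measurable_continuous_on_if Db continuous_intros) (auto intro: continuous_on_subset)
  have [measurable]: "k u \<in> borel_measurable borel" "k (v n) \<in> borel_measurable borel" for n
    using uK continuous_on_subset[OF vh(2)] by (auto intro: k_meas)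
  have k_nonneg: "k f x \<ge> 0" for f x by (simp add: k_def)
  have k_lim: "uniform_limit K (\<lambda>n. k (v n)) (k u) sequentially"
  proof (rule uniform_limitI)
    fix e :: real assume "e > 0"
    then have "\<forall>\<^sub>F n in sequentially. \<forall>x\<in>K. dist (v n x) (u x) < e / 2"
      by (intro uniform_limitD[OF v]) auto
    then show "\<forall>\<^sub>F n in sequentially. \<forall>x\<in>K. dist (k (v n) x) (k u x) < e"
    proof eventually_elim
      case (elim n)
      show ?case
      proof
        fix x assume "x \<in> K"
        then have "\<bar>v n x - u x\<bar> < e / 2" using elim by (auto simp: dist_real_def)
        moreover have "\<bar>2 * max 0 (w x - v n x - T) - 2 * max 0 (w x - u x - T)\<bar> \<le> 2 * \<bar>v n x - u x\<bar>"
          by (auto simp: max_def abs_if)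
        ultimately show "dist (k (v n) x) (k u x) < e"
          using \<open>e > 0\<close> by (auto simp: k_def dist_real_def)
      qed
    qed
  qed
  obtain E where E: "E \<ge> 0" "\<And>x. x \<in> K \<Longrightarrow> \<bar>k u x\<bar> \<le> E"
  proof -
    have "bounded ((\<lambda>x. 2 * max 0 (w x - u x - T)) ` K)"
      by (intro compact_imp_bounded compact_continuous_image continuous_intros wK uK K(1))
    then obtain E where "E > 0" "\<And>x. x \<in> K \<Longrightarrow> \<bar>2 * max 0 (w x - u x - T)\<bar> \<le> E"
      unfolding bounded_pos by auto
    then show thesis by (intro that[of E]) (auto simp: k_def)
  qed
  obtain A where A: "A > 0" "\<And>x. x \<in> K \<Longrightarrow> norm (W x) \<le> A"
    using compact_imp_bounded[OF compact_continuous_image[OF w(2) K(1)]] unfolding bounded_pos by auto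
  obtain Q where Q: "Q > 0" "\<And>x. x \<in> K \<Longrightarrow> norm x \<le> Q"
    using compact_imp_bounded[OF K(1)] unfolding bounded_pos by auto
  have g_fin: "(\<integral>\<^sup>+x\<in>K. norm (g x) powr p \<partial>lborel) < \<infinity>"
  proof -
    have "integrable lebesgue (\<lambda>x. indicator K x *\<^sub>R norm (g x) powr p)"
      using g(3) K by (auto simp: Lp_loc_def set_integrable_def)
    then have "integrable lborel (\<lambda>x. indicator K x *\<^sub>R norm (g x) powr p)"
      by (simp add: integrable_completion)
    then have "(\<integral>\<^sup>+x. ennreal (norm (indicator K x *\<^sub>R norm (g x) powr p)) \<partial>lborel) < \<infinity>"
      by (simp only: integrable_iff_bounded)
    also have "(\<integral>\<^sup>+x. ennreal (norm (indicator K x *\<^sub>R norm (g x) powr p)) \<partial>lborel) = (\<integral>\<^sup>+x\<in>K. norm (g x) powr p \<partial>lborel)"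
      by (intro nn_integral_cong) (auto simp: indicator_def)
    finally show ?thesis .
  qed
  \<comment> \<open>The pairings of a field \<open>B\<close> with the gradients of the test functions, and their limits.\<close>
  define flux where "flux B n = (LINT x|lborel. indicator K x * (k (v n) x * (B x \<bullet> (W' x - h n x))))" for B n
  define flux' where "flux' B = (LINT x|lborel. indicator K x * (k u x * (B x \<bullet> (W' x - g x))))" for B
  have W'A: "norm (W' x) \<le> A" if "x \<in> K" for x using A that by (simp add: W'_def)
  have flux_int: "integrable lborel (\<lambda>x. indicator K x * (k u x * (B x \<bullet> (W' x - g x))))"
    and flux_lim: "flux B \<longlonglongrightarrow> flux' B"
    if "B \<in> borel_measurable borel" "C \<ge> 0" "\<And>x. x \<in> K \<Longrightarrow> norm (B x) \<le> C * (1 + norm (g x)) powr (p - 1)" for B C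
  proof -
    have A0: "A \<ge> 0" using A by simp
    show "integrable lborel (\<lambda>x. indicator K x * (k u x * (B x \<bullet> (W' x - g x))))"
      by (rule integrable_weighted_flux[where C = C and D = A and E = E and p = p])
        (use K p g_fin that W'A E A0 in auto)
    show "flux B \<longlonglongrightarrow> flux' B"
      unfolding flux_def flux'_def
      by (rule weighted_flux_tendsto[where C = C and D = A and E = E and p = p])
        (use K p g_fin that W'A E A0 k_lim h in auto)
  qed
  have a1: "(1 + norm (g x)) powr (p - 1) \<ge> 1" for x
    using p by (intro ge_one_powr_ge_zero) auto
  have g_bound: "norm (plap_field r (g x)) \<le> 1 * (1 + norm (g x)) powr (p - 1)" if "1 < r" "r \<le> p" for r x
  proof -
    have "norm (g x) powr (r - 1) \<le> (1 + norm (g x)) powr (r - 1)"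
      using that by (intro powr_mono2) auto
    also have "\<dots> \<le> (1 + norm (g x)) powr (p - 1)"
      using that by (intro powr_mono) auto
    finally show ?thesis by (simp add: norm_plap_field)
  qed
  have W_bound: "norm (plap_field r (W' x)) \<le> A powr (r - 1) * (1 + norm (g x)) powr (p - 1)" if "1 < r" "x \<in> K" for r x
  proof -
    have "norm (plap_field r (W' x)) \<le> A powr (r - 1) * 1"
      unfolding norm_plap_field using that A W'A[of x] by (simp, intro powr_mono2) auto
    also have "\<dots> \<le> A powr (r - 1) * (1 + norm (g x)) powr (p - 1)"
      using a1 by (intro mult_left_mono) auto
    finally show ?thesis .
  qed
  have x_bound: "norm x \<le> Q * (1 + norm (g x)) powr (p - 1)" if "x \<in> K" for x
    using mult_mono[OF Q(2)[OF that] a1[of x]] Q(1) by simp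
  define \<Phi> where "\<Phi> n x = (if x \<in> D then (max 0 (w x - v n x - T))\<^sup>2 else 0)" for n x
  define \<Psi> where "\<Psi> n x = k (v n) x *\<^sub>R (W x - h n x)" for n x
  have \<Phi>_nonneg: "\<Phi> n x \<ge> 0" for n x by (simp add: \<Phi>_def)
  have close: "\<forall>\<^sub>F n in sequentially. \<forall>x\<in>K. dist (v n x) (u x) < \<delta> / 2"
    using \<delta> by (intro uniform_limitD[OF v]) auto
  have tf: "test_function D (\<Phi> n) (\<Psi> n)" if n: "\<forall>x\<in>K. dist (v n x) (u x) < \<delta> / 2" for n
  proof (rule test_function_glue[OF D(1) S SD])
    show "GDERIV (\<Phi> n) x :> \<Psi> n x" if x: "x \<in> D" for x
    proof -
      have xK: "x \<in> K" using x D(2) by auto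
      have "GDERIV (\<lambda>x. w x - v n x - T) x :> W x - h n x - 0"
        by (intro GDERIV_diff GDERIV_const w(1) vh(1) xK)
      from GDERIV_DERIV_compose[OF this DERIV_max_0_sq]
      have "GDERIV (\<lambda>x. (max 0 (w x - v n x - T))\<^sup>2) x :> \<Psi> n x"
        using x by (simp add: \<Psi>_def k_def)
      then show ?thesis
        by (rule GDERIV_transform_open[OF _ D(1) x]) (simp add: \<Phi>_def)
    qed
    have "continuous_on D (\<lambda>x. (2 * max 0 (w x - v n x - T)) *\<^sub>R (W x - h n x))"
      using D(2) by (intro continuous_intros continuous_on_subset[OF wK] continuous_on_subset[OF w(2)]
          continuous_on_subset[OF vh(2)] continuous_on_subset[OF vh(3)]) auto
    then show "continuous_on D (\<Psi> n)"
      by (rule continuous_on_eq) (simp add: \<Psi>_def k_def)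
    have z: "max 0 (w x - v n x - T) = 0" if "x \<notin> S" "x \<in> D" for x
    proof -
      have "x \<in> K" using that D(2) by auto
      then have "w x - u x < t" "dist (v n x) (u x) < \<delta> / 2"
        using that n by (auto simp: S_def)
      then show ?thesis using \<delta> by (auto simp: T_def dist_real_def abs_if split: if_splits)
    qed
    show "\<Phi> n x = 0" "\<Psi> n x = 0" if "x \<notin> S" for x
      using z[OF that] by (auto simp: \<Phi>_def \<Psi>_def k_def)
  qed
  have flux_eq: "B x \<bullet> \<Psi> n x = indicator K x * (k (v n) x * (B x \<bullet> (W' x - h n x)))" for B :: "'a \<Rightarrow> 'a" and n x
    using D(2) by (cases "x \<in> K") (auto simp: \<Psi>_def W'_def k_def)
  have "flux' (\<lambda>x. plap_field p (g x)) + flux' (\<lambda>x. plap_field q (g x)) \<ge> 0"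
  proof (rule tendsto_lowerbound)
    show "(\<lambda>n. flux (\<lambda>x. plap_field p (g x)) n + flux (\<lambda>x. plap_field q (g x)) n)
        \<longlonglongrightarrow> flux' (\<lambda>x. plap_field p (g x)) + flux' (\<lambda>x. plap_field q (g x))"
      using q by (intro tendsto_add flux_lim[where C = 1] g_bound) auto
    show "\<forall>\<^sub>F n in sequentially. 0 \<le> flux (\<lambda>x. plap_field p (g x)) n + flux (\<lambda>x. plap_field q (g x)) n"
      using close
    proof eventually_elim
      case (elim n)
      have eq: "(LINT x:\<Omega>|lebesgue. plap_field r (g x) \<bullet> \<Psi> n x) = flux (\<lambda>x. plap_field r (g x)) n" for r
      proof -
        have "(\<lambda>x. indicator \<Omega> x *\<^sub>R (plap_field r (g x) \<bullet> \<Psi> n x))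
            = (\<lambda>x. indicator K x * (k (v n) x * (plap_field r (g x) \<bullet> (W' x - h n x))))"
          unfolding flux_eq[of "\<lambda>x. plap_field r (g x)"] using K(2) by (auto simp: indicator_def fun_eq_iff)
        then show ?thesis
          unfolding set_lebesgue_integral_def flux_def by (simp add: integral_completion)
      qed
      show ?case
        using super[OF test_function_mono[OF tf[OF elim]] \<Phi>_nonneg] D(2) K(2) by (auto simp: eq)
    qed
  qed auto
  moreover have "flux' (\<lambda>x. plap_field p (W' x)) + flux' (\<lambda>x. plap_field q (W' x)) \<le> 0"
  proof (rule tendsto_upperbound)
    show "(\<lambda>n. flux (\<lambda>x. plap_field p (W' x)) n + flux (\<lambda>x. plap_field q (W' x)) n)
        \<longlonglongrightarrow> flux' (\<lambda>x. plap_field p (W' x)) + flux' (\<lambda>x. plap_field q (W' x))"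
      using p q by (intro tendsto_add flux_lim[where C = "A powr (p - 1)"] flux_lim[where C = "A powr (q - 1)"] W_bound) auto
    show "\<forall>\<^sub>F n in sequentially. flux (\<lambda>x. plap_field p (W' x)) n + flux (\<lambda>x. plap_field q (W' x)) n \<le> 0"
      using close
    proof eventually_elim
      case (elim n)
      have eq: "(LINT x|lborel. plap_field r (W x) \<bullet> \<Psi> n x) = flux (\<lambda>x. plap_field r (W' x)) n" for r
        unfolding flux_def flux_eq[of "\<lambda>x. plap_field r (W x)"]
        by (intro Bochner_Integration.integral_cong) (auto simp: W'_def indicator_def)
      show ?case
        using sub[OF tf[OF elim] \<Phi>_nonneg] by (simp add: eq)
    qed
  qed auto
  \<comment> \<open>The difference of the two limit inequalities for exponent \<open>r\<close>: pointwise nonnegative by monotonicity.\<close>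
  moreover define N where "N r x = indicator K x * (k u x * ((plap_field r (W' x) - plap_field r (g x)) \<bullet> (W' x - g x)))" for r x
  have N_nonneg: "N r x \<ge> 0" if "r > 1" for r x
    unfolding N_def using that k_nonneg by (intro mult_nonneg_nonneg plap_field_mono) auto
  have N_split: "N r = (\<lambda>x. indicator K x * (k u x * (plap_field r (W' x) \<bullet> (W' x - g x)))
      - indicator K x * (k u x * (plap_field r (g x) \<bullet> (W' x - g x))))" for r
    by (auto simp: N_def inner_diff_left algebra_simps fun_eq_iff)
  have N_int: "integrable lborel (N r)"
    and N_flux: "(LINT x|lborel. N r x) = flux' (\<lambda>x. plap_field r (W' x)) - flux' (\<lambda>x. plap_field r (g x))"
    if "1 < r" "r \<le> p" for r
  proof -
    have i: "integrable lborel (\<lambda>x. indicator K x * (k u x * (plap_field r (W' x) \<bullet> (W' x - g x))))"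
      using that by (intro flux_int[where C = "A powr (r - 1)"] W_bound) auto
    have j: "integrable lborel (\<lambda>x. indicator K x * (k u x * (plap_field r (g x) \<bullet> (W' x - g x))))"
      using that by (intro flux_int[where C = 1] g_bound) auto
    show "integrable lborel (N r)"
      unfolding N_split by (rule Bochner_Integration.integrable_diff[OF i j])
    show "(LINT x|lborel. N r x) = flux' (\<lambda>x. plap_field r (W' x)) - flux' (\<lambda>x. plap_field r (g x))"
      unfolding N_split flux'_def by (rule Bochner_Integration.integral_diff[OF i j])
  qed
  moreover have "(LINT x|lborel. N q x) \<ge> 0" "(LINT x|lborel. N p x) \<ge> 0"
    using N_nonneg p q by (auto intro!: Bochner_Integration.integral_nonneg)
  ultimately have "(LINT x|lborel. N p x) = 0"
    using p q N_flux[of p] N_flux[of q] by linarith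
  then have "AE x in lborel. N p x = 0"
    using N_int[of p] N_nonneg[of p] p by (subst (asm) integral_nonneg_eq_0_iff_AE) auto
  then have "AE x in lborel. indicator K x * (k u x * (x \<bullet> (W' x - g x))) = 0"
  proof eventually_elim
    case (elim x)
    then show ?case
      using plap_field_strict_mono[OF p, of "W' x" "g x"] by (cases "W' x = g x") (auto simp: N_def)
  qed
  then have "flux' (\<lambda>x. x) = 0"
    unfolding flux'_def by (rule integral_eq_zero_AE)
  moreover have "flux (\<lambda>x. x) \<longlonglongrightarrow> flux' (\<lambda>x. x)"
    using Q x_bound by (intro flux_lim[where C = Q]) auto
  ultimately have lim0: "(\<lambda>n. - flux (\<lambda>x. x) n / real DIM('a)) \<longlonglongrightarrow> 0"
    by (auto intro!: tendsto_eq_intros)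
  \<comment> \<open>The threshold leaves room for the error \<open>\<delta> / 2\<close> of \<open>v n\<close>, so that \<open>\<Phi> n \<ge> (\<delta> / 4)\<^sup>2\<close> on the ball.\<close>
  have pos_open: "open (D \<inter> (\<lambda>x. w x - u x) -` {T + 3/4 * \<delta><..})"
    using D by (intro continuous_open_preimage continuous_intros continuous_on_subset[OF wK] continuous_on_subset[OF uK]) auto
  moreover have "x0 \<in> D \<inter> (\<lambda>x. w x - u x) -` {T + 3/4 * \<delta><..}"
    using x0 \<delta> by auto
  ultimately obtain \<rho> where \<rho>: "\<rho> > 0" "cball x0 \<rho> \<subseteq> D \<inter> (\<lambda>x. w x - u x) -` {T + 3/4 * \<delta><..}"
    unfolding open_contains_cball by blast
  define c where "c = (\<delta> / 4)\<^sup>2 * measure lborel (cball x0 \<rho>)"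
  have "c > 0"
    using \<delta> \<rho> content_cball_pos[of \<rho> x0] by (simp add: c_def)
  have "\<forall>\<^sub>F n in sequentially. c \<le> - flux (\<lambda>x. x) n / real DIM('a)"
    using close
  proof eventually_elim
    case (elim n)
    note tfn = tf[OF elim]
    have \<Phi>_int: "integrable lborel (\<Phi> n)"
    proof (rule integrable_continuous_compact_support)
      show "continuous_on UNIV (\<Phi> n)"
        using tfn by (intro GDERIV_imp_continuous_on) (auto simp: test_function_def)
      show "compact (closure {x. \<Phi> n x \<noteq> 0})"
        using tfn by (simp add: test_function_def)
    qed (use test_function_eq_0[OF tfn] in blast)
    have "flux (\<lambda>x. x) n = (LINT x|lborel. \<Psi> n x \<bullet> x)"
      unfolding flux_def flux_eq[of "\<lambda>x. x", symmetric] by (simp add: inner_commute)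
    also have "\<dots> = - real DIM('a) * (LINT x|lborel. \<Phi> n x)"
      by (rule integral_gradient_inner_position[OF tfn])
    finally have "- flux (\<lambda>x. x) n / real DIM('a) = (LINT x|lborel. \<Phi> n x)"
      by simp
    moreover have "c = (LINT x|lborel. indicator (cball x0 \<rho>) x * (\<delta> / 4)\<^sup>2)"
      by (simp add: c_def)
    moreover have "\<dots> \<le> (LINT x|lborel. \<Phi> n x)"
    proof (rule integral_mono[OF _ \<Phi>_int])
      show "integrable lborel (\<lambda>x. indicator (cball x0 \<rho>) x * (\<delta> / 4)\<^sup>2)"
        using borel_integrable_compact[OF compact_cball, of x0 \<rho> "\<lambda>_. (\<delta> / 4)\<^sup>2"] by simp
      show "indicator (cball x0 \<rho>) x * (\<delta> / 4)\<^sup>2 \<le> \<Phi> n x" for x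
      proof (cases "x \<in> cball x0 \<rho>")
        case True
        then have "x \<in> D" "w x - u x > T + 3/4 * \<delta>" using \<rho>(2) by auto
        moreover have "dist (v n x) (u x) < \<delta> / 2" using elim \<open>x \<in> D\<close> D(2) by auto
        ultimately have le: "\<delta> / 4 \<le> max 0 (w x - v n x - T)"
          by (auto simp: dist_real_def abs_if split: if_splits)
        have "(\<delta> / 4)\<^sup>2 \<le> (max 0 (w x - v n x - T))\<^sup>2"
          by (rule power_mono[OF le]) (use \<delta> in simp)
        then show ?thesis using True \<open>x \<in> D\<close> by (simp add: \<Phi>_def)
      qed (simp add: \<Phi>_nonneg)
    qed
    ultimately show ?case by simp
  qed
  then have "c \<le> 0"
    by (intro tendsto_lowerbound[OF lim0]) auto
  with \<open>c > 0\<close> show False by simp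
qed

section \<open>Lower bounds at infinity\<close>

text \<open>
  Compare \<open>u\<close> with \<open>w = m (|x| / \<rho>)\<^sup>-\<^sup>\<theta>\<close> on the annulus \<open>\<rho> < |x| < L\<close>.  On the inner sphere \<open>w = m \<le> u\<close>; on the
  outer one \<open>w < \<epsilon>\<close> for large \<open>L\<close> while \<open>u > 0\<close>.  The factor \<open>m\<close> does not depend on \<open>\<theta>\<close>, which makes
  the limit of vanishing \<open>\<theta>\<close> useful.
\<close>

lemma radial_lower_bound:
  fixes u :: "'a::euclidean_space \<Rightarrow> real"
  assumes pq: "1 < q" "q \<le> p" and \<Omega>: "open \<Omega>" and u: "positive_solution p q \<Omega> u"
    and \<rho>: "\<rho> > 0" "{x. norm x \<ge> \<rho>} \<subseteq> \<Omega>"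
    and m: "m > 0" "\<And>x. norm x = \<rho> \<Longrightarrow> u x \<ge> m"
    and \<theta>: "\<theta> > 0" "\<theta> \<ge> (real DIM('a) - q) / (q - 1)" and x0: "norm x0 > \<rho>"
  shows "u x0 \<ge> m * (norm x0 / \<rho>) powr (- \<theta>)"
proof -
  have cont: "continuous_on \<Omega> u" and W1p: "W1p_loc p \<Omega> u" and pos: "\<And>x. x \<in> \<Omega> \<Longrightarrow> u x > 0"
    and super: "\<And>g \<phi> \<psi>. has_weak_gradient \<Omega> u g \<Longrightarrow> test_function \<Omega> \<phi> \<psi> \<Longrightarrow> (\<And>x. \<phi> x \<ge> 0) \<Longrightarrow>
         (LINT x:\<Omega>|lebesgue. plap_field p (g x) \<bullet> \<psi> x) + (LINT x:\<Omega>|lebesgue. plap_field q (g x) \<bullet> \<psi> x) \<ge> 0"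
    using u unfolding positive_solution_def by blast+
  obtain g where g: "g \<in> borel_measurable borel" "has_weak_gradient \<Omega> u g" "Lp_loc p \<Omega> g"
    using W1p_loc_borel_gradient[OF W1p \<Omega>] by blast
  define \<kappa> where "\<kappa> = m * \<rho> powr \<theta>"
  have \<kappa>: "\<kappa> > 0" using m \<rho> by (simp add: \<kappa>_def)
  define w where "w x = \<kappa> * norm x powr (- \<theta>)" for x :: 'a
  define W where "W x = - ((\<kappa> * \<theta>) * norm x powr (- \<theta> - 2)) *\<^sub>R x" for x :: 'a
  have w_eq: "w x = m * (norm x / \<rho>) powr (- \<theta>)" for x
    using \<rho> by (simp add: w_def \<kappa>_def powr_divide powr_minus field_simps)
  have \<theta>q: "\<theta> * (q - 1) \<ge> real DIM('a) - q"
    using \<theta>(2) pq by (simp add: pos_divide_le_eq)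
  have \<theta>p: "\<theta> * (p - 1) \<ge> real DIM('a) - p"
  proof -
    have "\<theta> * (q - 1) \<le> \<theta> * (p - 1)" using \<theta>(1) pq by (intro mult_left_mono) auto
    with \<theta>q pq show ?thesis by linarith
  qed
  have "w x0 - u x0 \<le> \<epsilon>" if \<epsilon>: "\<epsilon> > 0" for \<epsilon>
  proof -
    have "((\<lambda>L. \<kappa> * L powr (- \<theta>)) \<longlongrightarrow> \<kappa> * 0) at_top"
      using \<theta>(1) by (intro tendsto_mult tendsto_const tendsto_neg_powr filterlim_ident) auto
    then have "\<forall>\<^sub>F L in at_top. \<kappa> * L powr (- \<theta>) < \<epsilon>"
      using \<epsilon> by (intro order_tendstoD(2)) auto
    moreover have "\<forall>\<^sub>F L in at_top. L > norm x0"
      by (rule eventually_gt_at_top)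
    ultimately have "\<forall>\<^sub>F L in at_top. \<kappa> * L powr (- \<theta>) < \<epsilon> \<and> L > norm x0"
      by eventually_elim auto
    then obtain L where L: "\<kappa> * L powr (- \<theta>) < \<epsilon>" "L > norm x0"
      by (auto dest: eventually_happens)
    define K where "K = cball 0 L - ball (0::'a) \<rho>"
    define D where "D = ball 0 L - cball (0::'a) \<rho>"
    have K: "K = {x. \<rho> \<le> norm x \<and> norm x \<le> L}" by (auto simp: K_def)
    have D: "D = {x. \<rho> < norm x \<and> norm x < L}" by (auto simp: D_def)
    show ?thesis
    proof (rule weak_comparison[OF pq \<Omega> cont g])
      show "compact K" unfolding K_def by (intro compact_diff) auto
      show "open D" unfolding D_def by (intro open_Diff) auto
      show "K \<subseteq> \<Omega>" using \<rho>(2) by (auto simp: K)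
      show "D \<subseteq> K" by (auto simp: D K)
      show "x0 \<in> D" using x0 L(2) by (simp add: D)
      show "GDERIV w x :> W x" if "x \<in> K" for x
      proof -
        have "x \<noteq> 0" using that \<rho>(1) by (auto simp: K)
        from GDERIV_mult[OF GDERIV_const[where k = \<kappa>] GDERIV_norm_powr[OF this, of "- \<theta>"]]
        show ?thesis unfolding w_def[abs_def] W_def
          by (rule GDERIV_subst) (simp add: mult_ac)
      qed
      show "continuous_on K W"
        unfolding W_def using \<rho>(1) by (intro continuous_intros) (auto simp: K)
      show "w x - u x < \<epsilon>" if "x \<in> K - D" for x
      proof -
        from that consider "norm x = \<rho>" | "norm x = L" by (auto simp: K D)
        then show ?thesis
        proof cases
          case 1
          then have "w x = m" using \<rho>(1) by (simp add: w_eq)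
          with m(2)[OF 1] \<epsilon> show ?thesis by simp
        next
          case 2
          then have "x \<in> \<Omega>"
            by (intro subsetD[OF \<rho>(2)]) (use x0 L(2) in simp)
          then have "u x > 0" by (rule pos)
          with 2 L(1) show ?thesis by (simp add: w_def)
        qed
      qed
      show "(LINT x|lborel. plap_field p (W x) \<bullet> \<psi> x) + (LINT x|lborel. plap_field q (W x) \<bullet> \<psi> x) \<le> 0"
        if tf: "test_function D \<phi> \<psi>" and nonneg: "\<And>x. \<phi> x \<ge> 0" for \<phi> \<psi>
      proof -
        have "test_function (- {0}) \<phi> \<psi>"
          by (rule test_function_mono[OF tf]) (use \<rho>(1) in \<open>auto simp: D\<close>)
        then have "(LINT x|lborel. plap_field r (W x) \<bullet> \<psi> x) \<le> 0" if "\<theta> * (r - 1) \<ge> real DIM('a) - r" for r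
          unfolding W_def using \<kappa> \<theta>(1) that nonneg by (intro power_subsolution) auto
        from this[OF \<theta>p] this[OF \<theta>q] show ?thesis
          by simp
      qed
      show "(LINT x:\<Omega>|lebesgue. plap_field p (g x) \<bullet> \<psi> x) + (LINT x:\<Omega>|lebesgue. plap_field q (g x) \<bullet> \<psi> x) \<ge> 0"
        if "test_function \<Omega> \<phi> \<psi>" "\<And>x. \<phi> x \<ge> 0" for \<phi> \<psi>
        using that by (rule super[OF g(2)])
    qed
  qed
  then have "w x0 - u x0 \<le> 0"
    by (rule field_le_epsilon[where y = 0, simplified])
  then show ?thesis by (simp add: w_eq)
qed

lemma positive_min_on_sphere:
  fixes u :: "'a::euclidean_space \<Rightarrow> real"
  assumes "continuous_on \<Omega> u" "\<And>x. x \<in> \<Omega> \<Longrightarrow> u x > 0" "\<rho> > 0" "{x. norm x \<ge> \<rho>} \<subseteq> \<Omega>"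
  obtains m where "m > 0" "\<And>x. norm x = \<rho> \<Longrightarrow> u x \<ge> m"
proof -
  have sub: "sphere 0 \<rho> \<subseteq> \<Omega>" using assms(4) by auto
  have "sphere (0::'a) \<rho> \<noteq> {}" using assms(3) by simp
  then obtain y where y: "y \<in> sphere 0 \<rho>" "\<And>x. x \<in> sphere 0 \<rho> \<Longrightarrow> u y \<le> u x"
    using continuous_attains_inf[OF compact_sphere _ continuous_on_subset[OF assms(1) sub]] by blast
  show thesis
    by (rule that[of "u y"]) (use y sub assms(2) in auto)
qed

theorem lemma1p2:
  fixes p q R :: real
    and \<Omega> :: "'a::euclidean_space set"
    and u :: "'a \<Rightarrow> real"
  assumes "1 < q" and "q < p"
    and "exterior_domain \<Omega>"
    and "R > 0" and "{x. norm x > R} \<subseteq> \<Omega>"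
    and "positive_solution p q \<Omega> u"
  shows "(q < real DIM('a) \<longrightarrow>
            (\<forall>\<theta>. \<theta> > 0 \<and> \<theta> \<ge> (real DIM('a) - q) / (q - 1) \<longrightarrow>
              (\<forall>\<rho>\<ge>R. {x. norm x \<ge> \<rho>} \<subseteq> \<Omega> \<longrightarrow>
                (\<exists>\<kappa>>0. \<forall>x. norm x > \<rho> \<longrightarrow> u x \<ge> \<kappa> * norm x powr (- \<theta>)))))
       \<and> (q \<ge> real DIM('a) \<longrightarrow> Liminf at_infinity (\<lambda>x. ereal (u x)) > 0)"
proof (intro conjI impI allI)
  have \<Omega>: "open \<Omega>" and pq: "1 < q" "q \<le> p" and u: "continuous_on \<Omega> u" "\<And>x. x \<in> \<Omega> \<Longrightarrow> u x > 0"
    using assms by (auto simp: exterior_domain_def positive_solution_def)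
  note bound = radial_lower_bound[OF pq \<Omega> assms(6)]
  {
    fix \<theta> \<rho> assume \<theta>: "\<theta> > 0 \<and> \<theta> \<ge> (real DIM('a) - q) / (q - 1)" and \<rho>: "R \<le> \<rho>" "{x. norm x \<ge> \<rho>} \<subseteq> \<Omega>"
    have \<rho>0: "\<rho> > 0" using \<rho>(1) assms(4) by simp
    obtain m where m: "m > 0" "\<And>x. norm x = \<rho> \<Longrightarrow> u x \<ge> m"
      using positive_min_on_sphere[OF u \<rho>0 \<rho>(2)] by blast
    show "\<exists>\<kappa>>0. \<forall>x. norm x > \<rho> \<longrightarrow> u x \<ge> \<kappa> * norm x powr (- \<theta>)"
    proof (intro exI[of _ "m * \<rho> powr \<theta>"] conjI allI impI)
      show "m * \<rho> powr \<theta> > 0" using m \<rho>0 by simp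
      fix x :: 'a assume "norm x > \<rho>"
      from bound[OF \<rho>0 \<rho>(2) m _ _ this, of \<theta>] \<theta> \<rho>0
      show "u x \<ge> m * \<rho> powr \<theta> * norm x powr (- \<theta>)"
        by (simp add: powr_divide powr_minus field_simps)
    qed
  }
  assume N: "q \<ge> real DIM('a)"
  define \<rho> where "\<rho> = R + 1"
  have \<rho>0: "\<rho> > 0" and \<rho>: "{x. norm x \<ge> \<rho>} \<subseteq> \<Omega>"
    using assms(4,5) by (auto simp: \<rho>_def)
  obtain m where m: "m > 0" "\<And>x. norm x = \<rho> \<Longrightarrow> u x \<ge> m"
    using positive_min_on_sphere[OF u \<rho>0 \<rho>] by blast
  have "u x \<ge> m" if x: "norm x > \<rho>" for x
  proof (rule tendsto_upperbound)
    have "((\<lambda>\<theta>. m * (norm x / \<rho>) powr (- \<theta>)) \<longlongrightarrow> m * (norm x / \<rho>) powr (- 0)) (at_right 0)"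
      using x \<rho>0 by (intro tendsto_intros) auto
    then show "((\<lambda>\<theta>. m * (norm x / \<rho>) powr (- \<theta>)) \<longlongrightarrow> m) (at_right 0)"
      using x \<rho>0 by (cases "x = 0") auto
    show "\<forall>\<^sub>F \<theta> in at_right 0. m * (norm x / \<rho>) powr (- \<theta>) \<le> u x"
      using eventually_at_right_less
    proof eventually_elim
      case (elim \<theta>)
      have "(real DIM('a) - q) / (q - 1) \<le> \<theta>"
        using N pq(1) elim by (intro order_trans[OF divide_nonpos_pos]) auto
      with m elim x show ?case
        by (intro bound[OF \<rho>0 \<rho>]) auto
    qed
  qed auto
  then have "\<forall>\<^sub>F x in at_infinity. ereal m \<le> ereal (u x)"
    unfolding eventually_at_infinity by (intro exI[of _ "\<rho> + 1"]) force
  then have "ereal m \<le> Liminf at_infinity (\<lambda>x. ereal (u x))"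
    by (rule Liminf_bounded)
  with m(1) show "Liminf at_infinity (\<lambda>x. ereal (u x)) > 0"
    by (auto intro: less_le_trans[of 0 "ereal m"])
qed

end
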